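(* Let $L\ge 4$ be an even integer and let $\{X(t)\}_{t\ge 0}$ be the activity process on the $L\times L$ toric grid with parameters $\mu>0$ (fixed), $\nu>0$ and $p\in(0,1]$, and put $\sigma=\nu/(p\mu)$. Let $T_{\mathcal E\to\mathcal O}(\sigma)=\inf\{t>0: X(t)=\mathcal O\}$ for the process started at $X(0)=\mathcal E$. Let $\sigma\to\infty$ with $\mu$ fixed (by letting $\nu\to\infty$, or $p\downarrow 0$, or both), and define $\alpha:=\liminf_{\sigma\to\infty}\frac{\log p}{\log p-\log\nu}\ge 0$. Then $$\liminf_{\sigma\to\infty}\frac{\log \mathbb E\, T_{\mathcal E\to\mathcal O}(\sigma)}{\log\sigma}\;\ge\; L+\alpha\;\ge\; L .$$
   Context: Toric grid: $G=(V,E)$ with $V=\{1,\dots,L\}^2$, $L$ even, two vertices being adjacent iff they differ by $1 \pmod L$ in exactly one coordinate. A vertex is even (odd) if the sum of its coordinates is even (odd); $\mathcal E$ and $\mathcal O$ are the sets of even and odd vertices, each of size $L^2/2$. $\Omega$ is the collection of independent sets of $G$, identified with their indicator vectors in $\{0,1\}^V$. Activity process: $\{X(t)\}_{t\ge0}$ is the continuous-time Markov process on $\Omega$ which, from $I\in\Omega$, jumps to $I\cup\{v\}$ at rate $\nu$ for every $v\notin I$ with $I\cup\{v\}\in\Omega$, and to $I\setminus\{v\}$ at rate $p\mu$ for every $v\in I$. There are no other transitions. All limits as $\sigma\to\infty$ are taken along the given choice of $(\nu,p)$, with dependence on $(\nu,p)$ abbreviated as dependence on $\sigma$; $\alpha$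 is computed along the same choice of $(\nu,p)$. *)

theory Defs
  imports "HOL-Probability.Probability" "HOL-Number_Theory.Cong"
begin

type_synonym vertex = "nat \<times> nat"

definition torus_vertices :: "nat \<Rightarrow> vertex set" where
  "torus_vertices L = {1..L} \<times> {1..L}"

definition cyclic_neighbours :: "nat \<Rightarrow> nat \<Rightarrow> nat \<Rightarrow> bool" where
  "cyclic_neighbours L a b \<longleftrightarrow> [a = b + 1] (mod L) \<or> [b = a + 1] (mod L)"

definition torus_adj :: "nat \<Rightarrow> vertex \<Rightarrow> vertex \<Rightarrow> bool" where
  "torus_adj L u v \<longleftrightarrow>
     u \<in> torus_vertices L \<and> v \<in> torus_vertices L \<and>
     (fst u = fst v \<and> cyclic_neighbours L (snd u) (snd v) \<or>
      snd u = snd v \<and> cyclic_neighbours L (fst u) (fst v))"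

definition even_vertices :: "nat \<Rightarrow> vertex set" where
  "even_vertices L = {v \<in> torus_vertices L. even (fst v + snd v)}"

definition odd_vertices :: "nat \<Rightarrow> vertex set" where
  "odd_vertices L = {v \<in> torus_vertices L. odd (fst v + snd v)}"

definition independent_sets :: "nat \<Rightarrow> vertex set set" where
  "independent_sets L =
     {I. I \<subseteq> torus_vertices L \<and> (\<forall>u\<in>I. \<forall>v\<in>I. \<not> torus_adj L u v)}"

(* Transition functions on a finite state space S whose q-matrix has off-diagonal
   entries r x y. The diagonal entry is minus the sum over y in S - {x} of r x y:
   this follows from the off-diagonal limits because the rows sum to 1 and S is finite. *)
definition transition_function_with_rates ::
    "'s set \<Rightarrow> ('s \<Rightarrow> 's \<Rightarrow> real) \<Rightarrow> (real \<Rightarrow> 's \<Rightarrow> 's \<Rightarrow> real) \<Rightarrow> bool" where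
  "transition_function_with_rates S r P \<longleftrightarrow>
     finite S \<and>
     (\<forall>t\<ge>0. \<forall>x\<in>S. (\<forall>y\<in>S. 0 \<le> P t x y) \<and> (\<Sum>y\<in>S. P t x y) = 1) \<and>
     (\<forall>x\<in>S. \<forall>y\<in>S. P 0 x y = (if x = y then 1 else 0)) \<and>
     (\<forall>s\<ge>0. \<forall>t\<ge>0. \<forall>x\<in>S. \<forall>z\<in>S. P (s + t) x z = (\<Sum>y\<in>S. P s x y * P t y z)) \<and>
     (\<forall>x\<in>S. \<forall>y\<in>S. x \<noteq> y \<longrightarrow> ((\<lambda>h. P h x y / h) \<longlongrightarrow> r x y) (at_right 0))"

(* X is a time-homogeneous continuous-time Markov process on S, with jump rates r and
   initial state x0. Right-continuity is with respect to the discrete topology on S.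
   The Markov property is stated in product form, so that no conditioning on
   null events occurs. *)
definition markov_jump_process ::
    "'s set \<Rightarrow> ('s \<Rightarrow> 's \<Rightarrow> real) \<Rightarrow> 's \<Rightarrow> 'w measure \<Rightarrow> (real \<Rightarrow> 'w \<Rightarrow> 's) \<Rightarrow> bool" where
  "markov_jump_process S r x0 M X \<longleftrightarrow>
     prob_space M \<and>
     (\<forall>t\<ge>0. X t \<in> measurable M (count_space S)) \<and>
     (AE \<omega> in M. X 0 \<omega> = x0) \<and>
     (AE \<omega> in M. \<forall>t\<ge>0. \<forall>\<^sub>F s in at_right t. X s \<omega> = X t \<omega>) \<and>
     (\<exists>P. transition_function_with_rates S r P \<and>
        (\<forall>(n::nat) t x.
           0 \<le> t 0 \<longrightarrow> (\<forall>k\<le>n. t k < t (Suc k)) \<longrightarrow> (\<forall>k\<le>Suc n. x k \<in> S) \<longrightarrow>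
           measure M {\<omega> \<in> space M. \<forall>k\<le>Suc n. X (t k) \<omega> = x k} =
           measure M {\<omega> \<in> space M. \<forall>k\<le>n. X (t k) \<omega> = x k} *
             P (t (Suc n) - t n) (x n) (x (Suc n))))"

definition activity_rate ::
    "nat \<Rightarrow> real \<Rightarrow> real \<Rightarrow> real \<Rightarrow> vertex set \<Rightarrow> vertex set \<Rightarrow> real" where
  "activity_rate L \<nu> p \<mu> I J =
     (if \<exists>v. v \<notin> I \<and> J = I \<union> {v} \<and> I \<union> {v} \<in> independent_sets L then \<nu>
      else if \<exists>v\<in>I. J = I - {v} then p * \<mu>
      else 0)"

definition activity_process ::
    "nat \<Rightarrow> real \<Rightarrow> real \<Rightarrow> real \<Rightarrow> vertex set \<Rightarrow>
     'w measure \<Rightarrow> (real \<Rightarrow> 'w \<Rightarrow> vertex set) \<Rightarrow> bool" where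
  "activity_process L \<nu> p \<mu> I0 M X \<longleftrightarrow>
     markov_jump_process (independent_sets L) (activity_rate L \<nu> p \<mu>) I0 M X"

(* The value is \<infinity> if the state is never reached. *)
definition hitting_time :: "(real \<Rightarrow> 'w \<Rightarrow> 's) \<Rightarrow> 's \<Rightarrow> 'w \<Rightarrow> ennreal" where
  "hitting_time X y \<omega> = (INF t\<in>{t. 0 < t \<and> X t \<omega> = y}. ennreal t)"

definition ln_ennreal :: "ennreal \<Rightarrow> ereal" where
  "ln_ennreal x =
     (if x = 0 then -\<infinity> else if x = \<infinity> then \<infinity> else ereal (ln (enn2real x)))"

end

theory Submission
  imports Defs
begin

text \<open>
  The process is reversible with respect to \<open>\<pi>(I) = \<sigma>^|I|\<close>. Started in \<open>\<E>\<close>, its law at every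
  time is at most \<open>\<pi>/\<pi>(\<E>)\<close>, so it leaves a set \<open>A\<close> of states containing \<open>\<E>\<close> before time \<open>t\<close>
  with probability at most \<open>t/\<pi>(\<E>)\<close> times the equilibrium flow out of \<open>A\<close>. It remains to find
  such an \<open>A\<close> without \<open>\<O>\<close> whose exits all pass through sets of size at most \<open>L^2/2 - (L + 1)\<close>:
  then \<open>E T\<close> is at least a constant times \<open>\<sigma>^L/p\<close>, and \<open>1/p = (\<sigma>\<mu>)^a\<close> with
  \<open>a = log p/(log p - log \<nu>)\<close>.

  Two adjacent rows carry at most \<open>L\<close> particles, and if they carry at least \<open>L - 1\<close> then all of
  them have the same parity. The same holds for columns, and a nearly full pair of rows and a nearly
  full pair of columns agree on the parity because they cross. A set of size at least
  \<open>L^2/2 - L + 1\<close> has a nearly full pair of both kinds, so it has a well-defined parity, which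
  single-site updates preserve. In a set of size \<open>L^2/2 - L\<close> with two completions of different
  parity every pair of rows or columns would carry exactly \<open>L - 2\<close> particles, and comparing the
  pairs through the two added sites gives a contradiction.
\<close>


section \<open>Hard-core configurations on the discrete torus\<close>

text \<open>Coordinates range over all integers, with \<open>L\<close>-periodic occupation, so that
  strips wrap around without case distinctions. For even \<open>L\<close> the parity of
  \<open>i + j\<close> respects this periodicity.\<close>

definition hard_core :: "int \<Rightarrow> (int \<Rightarrow> int \<Rightarrow> bool) \<Rightarrow> bool" where
  "hard_core L f \<longleftrightarrow>
     (\<forall>i i' j j'. [i = i'] (mod L) \<longrightarrow> [j = j'] (mod L) \<longrightarrow> f i j = f i' j') \<and>
     (\<forall>i j. f i j \<longrightarrow> \<not> f (i + 1) j \<and> \<not> f i (j + 1))"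

definition strip_weight :: "int \<Rightarrow> (int \<Rightarrow> int \<Rightarrow> bool) \<Rightarrow> int \<Rightarrow> int" where
  "strip_weight L f i = (\<Sum>j\<in>{0..<L}. of_bool (f i j) + of_bool (f (i + 1) j))"

definition weight :: "int \<Rightarrow> (int \<Rightarrow> int \<Rightarrow> bool) \<Rightarrow> int" where
  "weight L f = (\<Sum>i\<in>{0..<L}. \<Sum>j\<in>{0..<L}. of_bool (f i j))"

text \<open>
  Each column meets the rows \<open>i\<close> and \<open>i + 1\<close> in one site of parity \<open>b\<close>; all of these sites are
  occupied, with at most one exception modulo \<open>L\<close>.
\<close>

definition filled :: "int \<Rightarrow> bool \<Rightarrow> (int \<Rightarrow> int \<Rightarrow> bool) \<Rightarrow> int \<Rightarrow> bool" where
  "filled L b f i \<longleftrightarrow>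
     (\<exists>e. \<forall>j. \<not> [j = e] (mod L) \<longrightarrow> f (if even (i + j) = b then i else i + 1) j)"

abbreviation (input) flip :: "(int \<Rightarrow> int \<Rightarrow> bool) \<Rightarrow> int \<Rightarrow> int \<Rightarrow> bool" where
  "flip f \<equiv> \<lambda>i j. f j i"

lemma even_cong:
  fixes L :: int
  assumes "even L" "[i = i'] (mod L)"
  shows "even i = even i'"
  using cong_dvd_iff[OF cong_dvd_modulus[OF assms(2,1)]] .

lemma hard_core_cong:
  "hard_core L f \<Longrightarrow> [i = i'] (mod L) \<Longrightarrow> [j = j'] (mod L) \<Longrightarrow> f i j = f i' j'"
  unfolding hard_core_def by blast

lemma hard_core_step:
  assumes "hard_core L f" "f i j"
  shows "\<not> f (i + 1) j" "\<not> f i (j + 1)"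
  using assms unfolding hard_core_def by blast+

lemma hard_core_flip: "hard_core L f \<Longrightarrow> hard_core L (flip f)"
  using hard_core_cong[of L f] hard_core_step[of L f] unfolding hard_core_def[of L "flip f"] by simp

text \<open>Two sites of a two-by-two block with different parities are neighbours, so they cannot
  both be occupied. Parities of overlapping strips are compared below by finding both in one such
  block.\<close>

lemma hard_core_block:
  assumes "hard_core L f" "f x y" "f x' y'" "x \<in> {i, i + 1}" "x' \<in> {i, i + 1}"
    "y \<in> {k, k + 1}" "y' \<in> {k, k + 1}"
  shows "even (x + y) = even (x' + y')"
  using assms(2-) hard_core_step[OF assms(1)] by auto

lemma weight_flip: "weight L (flip f) = weight L f"
  unfolding weight_def by (rule sum.swap)

lemma sum_periodic_shift:
  fixes h :: "int \<Rightarrow> int"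
  assumes "0 < L" and h: "\<And>i i'. [i = i'] (mod L) \<Longrightarrow> h i = h i'"
  shows "(\<Sum>i\<in>{0..<L}. h (i + 1)) = (\<Sum>i\<in>{0..<L}. h i)"
proof (rule sum.reindex_bij_witness[where j = "\<lambda>i. (i + 1) mod L" and i = "\<lambda>i. (i - 1) mod L"])
  fix a assume "a \<in> {0..<L}"
  then show "((a + 1) mod L - 1) mod L = a" "((a - 1) mod L + 1) mod L = a"
    by (simp_all add: mod_diff_left_eq mod_add_left_eq)
  show "(a + 1) mod L \<in> {0..<L}" "(a - 1) mod L \<in> {0..<L}"
    using \<open>0 < L\<close> by simp_all
  show "h ((a + 1) mod L) = h (a + 1)"
    by (rule h) (simp add: cong_def)
qed

section \<open>Strip weights and the parity of nearly full strips\<close>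

lemma sum_strip_weight:
  assumes "hard_core L f" "0 < L"
  shows "(\<Sum>i\<in>{0..<L}. strip_weight L f i) = 2 * weight L f"
proof -
  have "(\<Sum>i\<in>{0..<L}. \<Sum>j\<in>{0..<L}. of_bool (f (i + 1) j) :: int) = weight L f"
    unfolding weight_def
    by (rule sum_periodic_shift[OF \<open>0 < L\<close>])
       (intro sum.cong refl arg_cong[where f = of_bool] hard_core_cong[OF assms(1)] cong_refl, assumption)
  then show ?thesis
    by (simp add: strip_weight_def sum.distrib weight_def)
qed

text \<open>The two sites of a column in the strip are neighbours, so a column contributes at most
  1, and weight \<open>L - 1\<close> leaves at most one column \<open>e\<close> empty. In
  consecutive nonempty columns the particles alternate between the two rows and hence keep their
  parity; this is followed once around the torus, starting at \<open>e + 1\<close>.\<close>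

lemma filled_if_heavy:
  assumes hc: "hard_core L f" and L: "even L" "2 \<le> L" and heavy: "L - 1 \<le> strip_weight L f i"
  shows "\<exists>b. filled L b f i"
proof -
  have le1: "of_bool (f i j) + of_bool (f (i + 1) j) \<le> (1::int)" for j
    using hard_core_step(1)[OF hc, of i j] by auto
  have "\<exists>e. \<forall>j\<in>{0..<L}. j \<noteq> e \<longrightarrow> f i j \<or> f (i + 1) j"
  proof (rule ccontr)
    assume "\<not> ?thesis"
    then obtain j where j: "j \<in> {0..<L}" "\<not> f i j" "\<not> f (i + 1) j" by blast
    with \<open>\<not> ?thesis\<close> obtain k where k: "k \<in> {0..<L}" "k \<noteq> j" "\<not> f i k" "\<not> f (i + 1) k"
      by blast
    have "strip_weight L f i = (\<Sum>j\<in>{0..<L} - {j, k}. of_bool (f i j) + of_bool (f (i + 1) j))"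
      unfolding strip_weight_def using j k by (intro sum.mono_neutral_right) auto
    also have "\<dots> \<le> (\<Sum>j\<in>{0..<L} - {j, k}. 1)"
      by (rule sum_mono) (rule le1)
    also have "\<dots> = L - 2"
      using j k by (simp add: card_Diff_subset) (use L in linarith)
    finally show False using heavy by simp
  qed
  then obtain e where e: "\<And>j. j \<in> {0..<L} \<Longrightarrow> j \<noteq> e \<Longrightarrow> f i j \<or> f (i + 1) j" by blast
  have e': "f i j \<or> f (i + 1) j" if "\<not> [j = e] (mod L)" for j
  proof -
    have "j mod L \<in> {0..<L}" "j mod L \<noteq> e"
      using that L by (auto simp: cong_def)
    from e[OF this] show ?thesis
      using hard_core_cong[OF hc, of i i "j mod L" j] hard_core_cong[OF hc, of "i + 1" "i + 1" "j mod L" j]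
      by (simp add: cong_def)
  qed
  define row where "row b j = (if even (i + j) = b then i else i + 1)" for b j
  \<comment> \<open>For \<open>n\<close> from 0 to \<open>L - 2\<close> the columns
    \<open>e + 1 + n\<close> represent every residue except that of \<open>e\<close>.\<close>
  have ne: "\<not> [e + 1 + int n = e] (mod L)" if "int n \<le> L - 2" for n
    using that L by (simp add: cong_iff_dvd_diff zdvd_not_zless)
  obtain b where b: "f (row b (e + 1)) (e + 1)"
  proof -
    have "f i (e + 1) \<or> f (i + 1) (e + 1)"
      using e'[of "e + 1"] ne[of 0] L by simp
    moreover define q where "q = even (i + (e + 1))"
    ultimately show thesis
      using that[of q] that[of "\<not> q"] unfolding row_def q_def[symmetric] by auto
  qed
  have walk: "f (row b (e + 1 + int n)) (e + 1 + int n)" if "int n \<le> L - 2" for n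
    using that
  proof (induction n)
    case 0
    then show ?case using b by simp
  next
    case (Suc n)
    let ?j = "e + 1 + int n"
    have j: "e + 1 + int (Suc n) = ?j + 1" by simp
    \<comment> \<open>The next site in the same row is empty, so the particle of the next column is
      in the other row. As \<open>even (i + j)\<close> flips with \<open>j\<close>,
      \<open>row b\<close> changes row as well.\<close>
    have "f (row b ?j) ?j" using Suc by simp
    then have "\<not> f (row b ?j) (?j + 1)"
      by (rule hard_core_step[OF hc])
    moreover have "f i (?j + 1) \<or> f (i + 1) (?j + 1)"
      using e' ne[OF Suc.prems] unfolding j by blast
    ultimately show ?case
      unfolding j row_def by (auto split: if_splits)
  qed
  have "f (row b j) j" if "\<not> [j = e] (mod L)" for j
  proof -
    define n where "n = nat ((j - e - 1) mod L)"
    have "(j - e - 1) mod L \<noteq> L - 1"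
    proof
      assume "(j - e - 1) mod L = L - 1"
      then have "[j - e - 1 = - 1] (mod L)"
        using L by (simp add: cong_def zmod_minus1)
      then have "[j - e - 1 + (e + 1) = - 1 + (e + 1)] (mod L)"
        by (rule cong_add) simp
      then show False using that by simp
    qed
    moreover have "(j - e - 1) mod L < L"
      using L by simp
    moreover have [simp]: "int n = (j - e - 1) mod L"
      using L by (simp add: n_def)
    ultimately have n: "int n \<le> L - 2" by linarith
    have c: "[e + 1 + int n = j] (mod L)"
      by (simp add: cong_def mod_add_right_eq)
    then have "even (e + 1 + int n) = even j"
      by (rule even_cong[OF L(1)])
    then have "row b (e + 1 + int n) = row b j"
      by (simp add: row_def)
    with walk[OF n] hard_core_cong[OF hc cong_refl c, of "row b j"] show ?thesis
      by simp
  qed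
  then show ?thesis
    unfolding filled_def row_def by blast
qed

lemma filled_mono:
  "filled L b f i \<Longrightarrow> (\<And>i j. f i j \<Longrightarrow> g i j) \<Longrightarrow> filled L b g i"
  unfolding filled_def by blast

text \<open>Columns \<open>k\<close> and \<open>k + 1\<close> differ modulo \<open>L\<close>, so at
  most one of them is the exceptional column of the strip.\<close>

lemma filled_block:
  assumes "filled L b f i" "2 \<le> L"
  obtains x y where "x \<in> {i, i + 1}" "y \<in> {k, k + 1}" "f x y" "even (x + y) = b"
proof -
  obtain e where e: "\<And>j. \<not> [j = e] (mod L) \<Longrightarrow> f (if even (i + j) = b then i else i + 1) j"
    using assms unfolding filled_def by blast
  have "\<not> [k + 1 = k] (mod L)"
    using \<open>2 \<le> L\<close> by (simp add: cong_iff_dvd_diff)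
  then obtain y where y: "y \<in> {k, k + 1}" "\<not> [y = e] (mod L)"
    by (meson cong_sym cong_trans insertI1 insertI2)
  show thesis
    by (rule that[OF _ y(1) e[OF y(2)]]) auto
qed

text \<open>The row strip and the column strip cross in a two-by-two block, and each puts a particle
  of its parity there.\<close>

lemma filled_flip_agree:
  assumes "hard_core L f" "2 \<le> L" "filled L b f i" "filled L b' (flip f) k"
  shows "b = b'"
proof -
  obtain x y where *: "x \<in> {i, i + 1}" "y \<in> {k, k + 1}" "f x y" "even (x + y) = b"
    using filled_block assms(2,3) by blast
  obtain y' x' where **: "y' \<in> {k, k + 1}" "x' \<in> {i, i + 1}" "f x' y'" "even (y' + x') = b'"
    using filled_block assms(2,4) by blast
  show ?thesis
    using hard_core_block[OF assms(1) *(3) **(3) *(1) **(2) *(2) **(1)] *(4) **(4)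
    by (simp add: add.commute)
qed

text \<open>Averaging: the strip weights sum to twice the weight, which exceeds
  \<open>L * (L - 2)\<close>, so some strip weighs more than \<open>L - 2\<close>.\<close>

lemma ex_filled:
  assumes "hard_core L f" "even L" "2 \<le> L" "L * L - 2 * L + 2 \<le> 2 * weight L f"
  shows "\<exists>i b. filled L b f i"
proof -
  have "\<exists>i\<in>{0..<L}. L - 1 \<le> strip_weight L f i"
  proof (rule ccontr)
    assume "\<not> ?thesis"
    then have "(\<Sum>i\<in>{0..<L}. strip_weight L f i) \<le> (\<Sum>i\<in>{0..<L}. L - 2)"
      by (intro sum_mono) force
    then have "2 * weight L f \<le> L * (L - 2)"
      using sum_strip_weight[OF assms(1)] assms(3) by simp
    then show False using assms(4) by (simp add: algebra_simps)
  qed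
  then show ?thesis using filled_if_heavy assms by blast
qed

text \<open>Two row strips may be disjoint, so they are compared through a filled column strip,
  which exists by the same bound and crosses both.\<close>

lemma filled_unique:
  assumes "hard_core L f" "even L" "2 \<le> L" "L * L - 2 * L + 2 \<le> 2 * weight L f"
    and "filled L b f i" "filled L b' f i'"
  shows "b = b'"
proof -
  obtain k c where "filled L c (flip f) k"
    using ex_filled[OF hard_core_flip[OF assms(1)]] assms weight_flip[of L f] by auto
  then show ?thesis
    using filled_flip_agree assms by blast
qed

section \<open>Configurations of the critical size L^2/2 - L\<close>

lemma strip_weight_balanced:
  assumes "hard_core L f" "even L" "2 \<le> L" "2 * weight L f = L * L - 2 * L"
    and none: "\<And>i b. \<not> filled L b f i"
  shows "strip_weight L f i = L - 2"
proof -
  have le: "strip_weight L f i \<le> L - 2" for i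
    using filled_if_heavy[OF assms(1-3), of i] none by fastforce
  have "strip_weight L f i = strip_weight L f (i mod L)"
    unfolding strip_weight_def
    by (intro sum.cong refl arg_cong2[where f = plus] arg_cong[where f = of_bool]
          hard_core_cong[OF assms(1)]) (simp_all add: cong_def mod_add_left_eq)
  \<comment> \<open>Every strip weighs at most \<open>L - 2\<close> and the total is exactly
    \<open>L * (L - 2)\<close>, so one lighter strip would make the sum too small.\<close>
  moreover have "strip_weight L f (i mod L) = L - 2"
  proof (rule ccontr)
    assume "\<not> ?thesis"
    then have "(\<Sum>i\<in>{0..<L}. strip_weight L f i) < (\<Sum>i\<in>{0..<L}. L - 2)"
      using le le_neq_trans[OF le] assms(3)
      by (intro sum_strict_mono_ex1) (auto intro!: bexI[of _ "i mod L"])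
    then show False
      using sum_strip_weight[OF assms(1)] assms(3,4) by (simp add: algebra_simps)
  qed
  ultimately show ?thesis by simp
qed

lemma strip_weight_less:
  assumes "hard_core L f" "hard_core L g" "0 < L" and mono: "\<And>i j. f i j \<Longrightarrow> g i j"
    and "\<not> f r c" "g r c" "r \<in> {i, i + 1}"
  shows "strip_weight L f i < strip_weight L g i"
  unfolding strip_weight_def
proof (rule sum_strict_mono_ex1)
  have "\<not> f r (c mod L)" "g r (c mod L)"
    using assms hard_core_cong[OF assms(1) cong_refl, of "c mod L" c r]
      hard_core_cong[OF assms(2) cong_refl, of "c mod L" c r] by (simp_all add: cong_def)
  then have "of_bool (f i (c mod L)) + of_bool (f (i + 1) (c mod L))
    < (of_bool (g i (c mod L)) + of_bool (g (i + 1) (c mod L)) :: int)"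
    using assms(7) mono[of i "c mod L"] mono[of "i + 1" "c mod L"] by auto
  then show "\<exists>j\<in>{0..<L}. of_bool (f i j) + of_bool (f (i + 1) j)
    < (of_bool (g i j) + of_bool (g (i + 1) j) :: int)"
    using \<open>0 < L\<close> by (intro bexI[of _ "c mod L"]) auto
qed (auto simp: mono intro!: add_mono)

text \<open>Both strips contain row \<open>s\<close>. Their other rows \<open>s - 1\<close> and
  \<open>s + 1\<close> are distinct modulo \<open>L \<ge> 3\<close>, so \<open>r\<close> can lie in
  only one of the two strips.\<close>

lemma strip_avoiding:
  fixes r s L :: int
  assumes "3 \<le> L" "\<not> [r = s] (mod L)"
  obtains i where "i \<in> {s - 1, s}" "\<not> [i = r] (mod L)" "\<not> [i + 1 = r] (mod L)"
proof (cases "[s + 1 = r] (mod L)")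
  case False
  show ?thesis
    by (rule that[of s]) (use assms False cong_sym in auto)
next
  case True
  have "\<not> [s - 1 = s + 1] (mod L)"
    using \<open>3 \<le> L\<close> by (auto simp: cong_iff_dvd_diff dest: zdvd_imp_le)
  then show ?thesis
    by (intro that[of "s - 1"]) (use True assms(2) cong_trans[OF _ cong_sym[OF True]] in \<open>auto simp: cong_sym_eq\<close>)
qed

text \<open>All strips of \<open>f\<close> weigh exactly \<open>L - 2\<close>, so a new particle
  lifts both strips through its row to the threshold \<open>L - 1\<close>.\<close>

lemma filled_after_adding:
  assumes "hard_core L f" "hard_core L g" "even L" "2 \<le> L"
    and "2 * weight L f = L * L - 2 * L" "\<And>i b. \<not> filled L b f i"
    and "\<And>i j. f i j \<Longrightarrow> g i j" "\<not> f r c" "g r c" "i \<in> {r - 1, r}"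
  shows "\<exists>b. filled L b g i"
proof (rule filled_if_heavy[OF assms(2-4)])
  have "r \<in> {i, i + 1}" using assms(10) by auto
  then have "strip_weight L f i < strip_weight L g i"
    using strip_weight_less[OF assms(1,2) _ assms(7-9)] assms(4) by simp
  then show "L - 1 \<le> strip_weight L g i"
    using strip_weight_balanced[OF assms(1,3-6)] by simp
qed

lemma filled_cong:
  assumes "hard_core L f" "even L" "[i = i'] (mod L)"
  shows "filled L b f i = filled L b f i'"
proof -
  have "f i j = f i' j" "f (i + 1) j = f (i' + 1) j" for j
    by (intro hard_core_cong[OF assms(1)] cong_add assms(3) cong_refl)+
  moreover have "even (i + j) = even (i' + j)" for j
    using even_cong[OF assms(2,3)] by simp
  ultimately have "f (if even (i + j) = b then i else i + 1) j
      = f (if even (i' + j) = b then i' else i' + 1) j" for j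
    by (cases "even (i' + j) = b") simp_all
  then show ?thesis
    unfolding filled_def by simp
qed

text \<open>In one strip, \<open>f\<close> shows parity \<open>b\<close> outside two columns and
  parity \<open>b'\<close> outside two columns. Three consecutive columns are pairwise incongruent,
  so each parity survives in one of any three; two such columns can be chosen next to each other,
  where the parities collide.\<close>

lemma strip_conflict:
  assumes f: "hard_core L f" and "3 \<le> L"
    and b: "\<And>j. \<not> [j = e] (mod L) \<Longrightarrow> \<not> [j = c] (mod L) \<Longrightarrow> f (if even (i + j) = b then i else i + 1) j"
    and b': "\<And>j. \<not> [j = e'] (mod L) \<Longrightarrow> \<not> [j = c'] (mod L) \<Longrightarrow> f (if even (i + j) = b' then i else i + 1) j"
  shows "b = b'"
proof (rule ccontr)
  assume "b \<noteq> b'"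
  have distinct3: "\<exists>k\<in>{j - 1, j, j + 1}. \<not> [k = u] (mod L) \<and> \<not> [k = v] (mod L)" for j u v
  proof -
    have "\<not> [j - 1 = j] (mod L)" "\<not> [j = j + 1] (mod L)" "\<not> [j - 1 = j + 1] (mod L)"
      using \<open>3 \<le> L\<close> by (auto simp: cong_iff_dvd_diff dest: zdvd_imp_le)
    then show ?thesis by (meson cong_sym cong_trans insertCI)
  qed
  obtain j where j: "\<not> [j = e] (mod L)" "\<not> [j = c] (mod L)"
    using distinct3[of 0 e c] by blast
  obtain k where k: "k \<in> {j - 1, j, j + 1}" "\<not> [k = e'] (mod L)" "\<not> [k = c'] (mod L)"
    using distinct3[of j e' c'] by blast
  define x y where "x = (if even (i + j) = b then i else i + 1)"
    and "y = (if even (i + k) = b' then i else i + 1)"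
  have "f x j" "f y k"
    using b[OF j] b'[OF k(2,3)] unfolding x_def y_def .
  moreover have xy: "x \<in> {i, i + 1}" "y \<in> {i, i + 1}" and par: "even (x + j) = b" "even (y + k) = b'"
    by (auto simp: x_def y_def)
  \<comment> \<open>\<open>j\<close> and \<open>k\<close> differ by at most 1, so two consecutive
    columns contain both.\<close>
  moreover obtain l where "j \<in> {l, l + 1}" "k \<in> {l, l + 1}"
  proof (cases "k = j - 1")
    case True
    then show thesis by (intro that[of "j - 1"]) auto
  next
    case False
    then show thesis using k(1) by (intro that[of j]) auto
  qed
  ultimately have "even (x + j) = even (y + k)"
    by (intro hard_core_block[OF f])
  with par \<open>b \<noteq> b'\<close> show False by simp
qed

text \<open>The case of two additions in the same row. Outside the columns \<open>c\<close> and
  \<open>c'\<close> of the new particles the filled strips are already present in \<open>f\<close>,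
  so \<open>strip_conflict\<close> applies with one exceptional and one added column for each
  parity.\<close>

lemma filled_added_same_strip:
  assumes "hard_core L f" "hard_core L h" "even L" "3 \<le> L" "[r = r'] (mod L)"
    and g: "filled L b g r" "\<And>i j. g i j \<Longrightarrow> f i j \<or> [j = c] (mod L)"
    and h: "filled L b' h r'" "\<And>i j. h i j \<Longrightarrow> f i j \<or> [j = c'] (mod L)"
  shows "b = b'"
proof -
  have "filled L b' h r"
    using h(1) filled_cong[OF assms(2,3,5)] by simp
  then obtain e' where e': "\<And>j. \<not> [j = e'] (mod L) \<Longrightarrow> h (if even (r + j) = b' then r else r + 1) j"
    unfolding filled_def by blast
  obtain e where e: "\<And>j. \<not> [j = e] (mod L) \<Longrightarrow> g (if even (r + j) = b then r else r + 1) j"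
    using g(1) unfolding filled_def by blast
  show ?thesis
  proof (rule strip_conflict[OF assms(1,4), of e c r b e' c' b'])
    fix j
    show "f (if even (r + j) = b then r else r + 1) j" if "\<not> [j = e] (mod L)" "\<not> [j = c] (mod L)"
      using g(2)[OF e[OF that(1)]] that(2) by simp
    show "f (if even (r + j) = b' then r else r + 1) j" if "\<not> [j = e'] (mod L)" "\<not> [j = c'] (mod L)"
      using h(2)[OF e'[OF that(1)]] that(2) by simp
  qed
qed

text \<open>If the parities differed, \<open>f\<close> would have no filled strip, and every strip
  through an added site would be filled in \<open>g\<close> or \<open>h\<close> respectively. Sites
  in a common row or column are excluded by \<open>filled_added_same_strip\<close>. Otherwise a
  column strip of \<open>g\<close> and a row strip of \<open>h\<close> cross in a block that avoids
  both added sites, so \<open>f\<close> itself would have particles of both parities there.\<close>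

lemma added_particles_same_type:
  assumes f: "hard_core L f" and g: "hard_core L g" and h: "hard_core L h"
    and L: "even L" "4 \<le> L"
    and wf: "2 * weight L f = L * L - 2 * L"
    and wg: "L * L - 2 * L + 2 \<le> 2 * weight L g"
    and wh: "L * L - 2 * L + 2 \<le> 2 * weight L h"
    and fg: "\<And>i j. f i j \<Longrightarrow> g i j" and gf: "\<And>i j. g i j \<Longrightarrow> f i j \<or> [i = r] (mod L) \<and> [j = c] (mod L)"
    and fh: "\<And>i j. f i j \<Longrightarrow> h i j" and hf: "\<And>i j. h i j \<Longrightarrow> f i j \<or> [i = r'] (mod L) \<and> [j = c'] (mod L)"
    and v: "\<not> f r c" "g r c" and w: "\<not> f r' c'" "h r' c'"
    and b: "filled L b g i0" and b': "filled L b' h i0'"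
  shows "b = b'"
proof (rule ccontr)
  assume "b \<noteq> b'"
  have L2: "2 \<le> L" and L3: "3 \<le> L" using L by simp_all
  have gT: "d = b" if "filled L d g i" for d i
    using filled_unique[OF g L(1) L2 wg that b] .
  have hT: "d = b'" if "filled L d h i" for d i
    using filled_unique[OF h L(1) L2 wh that b'] .
  have gT': "d = b" if "filled L d (flip g) i" for d i
    using filled_flip_agree[OF g L2 b that] by simp
  have hT': "d = b'" if "filled L d (flip h) i" for d i
    using filled_flip_agree[OF h L2 b' that] by simp
  \<comment> \<open>A strip filled in \<open>f\<close> stays filled in \<open>g\<close> and in
    \<open>h\<close>, so its parity would be both \<open>b\<close> and \<open>b'\<close>.\<close>
  have nf: "\<not> filled L d f i" for d i
    using gT[OF filled_mono[of L d f i g]] hT[OF filled_mono[of L d f i h]] fg fh \<open>b \<noteq> b'\<close>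
    by blast
  have nf': "\<not> filled L d (flip f) i" for d i
    using gT'[OF filled_mono[of L d "flip f" i "flip g"]]
      hT'[OF filled_mono[of L d "flip f" i "flip h"]] fg fh \<open>b \<noteq> b'\<close>
    by blast
  have G: "filled L b g i" if "i \<in> {r - 1, r}" for i
    using filled_after_adding[OF f g L(1) L2 wf nf fg v that] gT by blast
  have H: "filled L b' h i" if "i \<in> {r' - 1, r'}" for i
    using filled_after_adding[OF f h L(1) L2 wf nf fh w that] hT by blast
  have wf': "2 * weight L (flip f) = L * L - 2 * L"
    unfolding weight_flip[of L f] by (rule wf)
  have G': "filled L b (flip g) i" if "i \<in> {c - 1, c}" for i
  proof -
    have "\<exists>b. filled L b (flip g) i"
      by (rule filled_after_adding[of L "flip f" "flip g" c r i, OF hard_core_flip[OF f]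
            hard_core_flip[OF g] L(1) L2 wf' nf' _ _ _ that])
        (rule nf' fg v | assumption)+
    then show ?thesis using gT' by blast
  qed
  have H': "filled L b' (flip h) i" if "i \<in> {c' - 1, c'}" for i
  proof -
    have "\<exists>b. filled L b (flip h) i"
      by (rule filled_after_adding[of L "flip f" "flip h" c' r' i, OF hard_core_flip[OF f]
            hard_core_flip[OF h] L(1) L2 wf' nf' _ _ _ that])
        (rule nf' fh w | assumption)+
    then show ?thesis using hT' by blast
  qed
  have ne: "\<not> [r = r'] (mod L)"
  proof
    assume rr: "[r = r'] (mod L)"
    have "b = b'"
      by (rule filled_added_same_strip[of L f h r r' b g c b' c', OF f h L(1) L3 rr])
        (use G H in simp_all, (drule gf hf, blast)+)
    with \<open>b \<noteq> b'\<close> show False ..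
  qed
  have ne': "\<not> [c' = c] (mod L)"
  proof
    assume "[c' = c] (mod L)"
    then have cc: "[c = c'] (mod L)" by (rule cong_sym)
    have "b = b'"
      by (rule filled_added_same_strip[of L "flip f" "flip h" c c' b "flip g" r b' r',
            OF hard_core_flip[OF f] hard_core_flip[OF h] L(1) L3 cc])
        (use G' H' in simp_all, (drule gf hf, blast)+)
    with \<open>b \<noteq> b'\<close> show False ..
  qed
  \<comment> \<open>The row strip \<open>s\<close> contains \<open>r'\<close> but not
    \<open>r\<close>, and the column strip \<open>t\<close> contains \<open>c\<close> but not
    \<open>c'\<close>. Thus \<open>h\<close> fills strip \<open>s\<close>, \<open>g\<close> fills
    strip \<open>t\<close>, and neither new particle lies in their intersection.\<close>
  obtain s where s: "s \<in> {r' - 1, r'}" "\<not> [s = r] (mod L)" "\<not> [s + 1 = r] (mod L)"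
    using strip_avoiding[OF L3 ne] by blast
  obtain t where t: "t \<in> {c - 1, c}" "\<not> [t = c'] (mod L)" "\<not> [t + 1 = c'] (mod L)"
    using strip_avoiding[OF L3 ne'] by blast
  obtain y x where 1: "y \<in> {t, t + 1}" "x \<in> {s, s + 1}" "g x y" "even (y + x) = b"
    using filled_block[OF G'[OF t(1)] L2, of s] by blast
  obtain x' y' where 2: "x' \<in> {s, s + 1}" "y' \<in> {t, t + 1}" "h x' y'" "even (x' + y') = b'"
    using filled_block[OF H[OF s(1)] L2, of t] by blast
  have "f x y" using gf[OF 1(3)] 1(2) s by auto
  moreover have "f x' y'" using hf[OF 2(3)] 2(2) t by auto
  ultimately show False
    using hard_core_block[OF f _ _ 1(2) 2(1) 1(1) 2(2)] 1(4) 2(4) \<open>b \<noteq> b'\<close>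
    by (simp add: add.commute)
qed

section \<open>Hitting times of reversible jump processes\<close>

lemma transition_function_offdiag_limit:
  assumes "transition_function_with_rates S r P" "x \<in> S" "y \<in> S" "x \<noteq> y"
  shows "((\<lambda>h. P h x y / h) \<longlongrightarrow> r x y) (at_right 0)"
  using assms unfolding transition_function_with_rates_def by simp

lemma transition_function_nonneg:
  assumes "transition_function_with_rates S r P" "0 \<le> t" "x \<in> S" "y \<in> S"
  shows "0 \<le> P t x y"
  using assms unfolding transition_function_with_rates_def by simp

lemma transition_function_sum:
  assumes "transition_function_with_rates S r P" "0 \<le> t" "x \<in> S"
  shows "(\<Sum>y\<in>S. P t x y) = 1"
  using assms unfolding transition_function_with_rates_def by simp

lemma transition_function_add:
  assumes "transition_function_with_rates S r P" "0 \<le> s" "0 \<le> t" "x \<in> S" "z \<in> S"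
  shows "P (s + t) x z = (\<Sum>y\<in>S. P s x y * P t y z)"
  using assms unfolding transition_function_with_rates_def by simp

lemma transition_function_zero:
  assumes "transition_function_with_rates S r P" "x \<in> S" "y \<in> S"
  shows "P 0 x y = (if x = y then 1 else 0)"
  using assms unfolding transition_function_with_rates_def by simp

lemma filterlim_divide_nat:
  fixes t :: real
  assumes "0 < t"
  shows "filterlim (\<lambda>n. t / real n) (at_right 0) sequentially"
proof (rule tendsto_imp_filterlim_at_right)
  show "(\<lambda>n. t / real n) \<longlonglongrightarrow> 0"
    by (rule lim_const_over_n)
  show "\<forall>\<^sub>F n in sequentially. 0 < t / real n"
    using eventually_gt_at_top[of 0] by eventually_elim (use assms in auto)
qed

definition l1_drift :: "'s set \<Rightarrow> ('s \<Rightarrow> real) \<Rightarrow> (real \<Rightarrow> 's \<Rightarrow> 's \<Rightarrow> real) \<Rightarrow> real \<Rightarrow> real" where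
  "l1_drift S \<pi> P t = (\<Sum>z\<in>S. \<bar>(\<Sum>x\<in>S. \<pi> x * P t x z) - \<pi> z\<bar>)"

text \<open>
  Since the drift is subadditive in time, it suffices for stationarity that it is \<open>o(h)\<close> as
  \<open>h \<rightarrow> 0\<close>; no differential equation for the transition function is needed.
\<close>

lemma l1_drift_add:
  assumes tf: "transition_function_with_rates S r P" and "0 \<le> s" "0 \<le> t"
  shows "l1_drift S \<pi> P (s + t) \<le> l1_drift S \<pi> P s + l1_drift S \<pi> P t"
proof -
  \<comment> \<open>With \<open>d = \<pi> P_s - \<pi>\<close> one has
    \<open>\<pi> P_(s+t) - \<pi> = d P_t + (\<pi> P_t - \<pi>)\<close>, and the stochastic matrix
    \<open>P_t\<close> does not increase the l1 norm of \<open>d\<close>.\<close>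
  define d where "d y = (\<Sum>x\<in>S. \<pi> x * P s x y) - \<pi> y" for y
  have eq: "(\<Sum>x\<in>S. \<pi> x * P (s + t) x z) - \<pi> z
      = (\<Sum>y\<in>S. d y * P t y z) + ((\<Sum>x\<in>S. \<pi> x * P t x z) - \<pi> z)" if "z \<in> S" for z
  proof -
    have "(\<Sum>x\<in>S. \<pi> x * P (s + t) x z) = (\<Sum>x\<in>S. \<Sum>y\<in>S. \<pi> x * P s x y * P t y z)"
      using transition_function_add[OF tf assms(2,3) _ that]
      by (simp add: sum_distrib_left mult.assoc)
    also have "\<dots> = (\<Sum>y\<in>S. (\<Sum>x\<in>S. \<pi> x * P s x y) * P t y z)"
      by (subst sum.swap) (simp add: sum_distrib_right)
    also have "\<dots> = (\<Sum>y\<in>S. d y * P t y z) + (\<Sum>x\<in>S. \<pi> x * P t x z)"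
      by (simp add: d_def algebra_simps sum_subtractf)
    finally show ?thesis by simp
  qed
  have "l1_drift S \<pi> P (s + t) \<le> (\<Sum>z\<in>S. \<bar>\<Sum>y\<in>S. d y * P t y z\<bar> + \<bar>(\<Sum>x\<in>S. \<pi> x * P t x z) - \<pi> z\<bar>)"
    unfolding l1_drift_def by (rule sum_mono) (simp add: eq abs_triangle_ineq)
  also have "\<dots> \<le> (\<Sum>z\<in>S. (\<Sum>y\<in>S. \<bar>d y\<bar> * P t y z) + \<bar>(\<Sum>x\<in>S. \<pi> x * P t x z) - \<pi> z\<bar>)"
    using transition_function_nonneg[OF tf \<open>0 \<le> t\<close>]
    by (intro sum_mono add_right_mono order_trans[OF sum_abs]) (simp add: abs_mult)
  also have "\<dots> = (\<Sum>y\<in>S. \<bar>d y\<bar> * (\<Sum>z\<in>S. P t y z)) + l1_drift S \<pi> P t"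
    unfolding sum.distrib l1_drift_def sum_distrib_left by (subst sum.swap) simp
  also have "(\<Sum>y\<in>S. \<bar>d y\<bar> * (\<Sum>z\<in>S. P t y z)) = l1_drift S \<pi> P s"
    using transition_function_sum[OF tf \<open>0 \<le> t\<close>] by (simp add: l1_drift_def d_def)
  finally show ?thesis .
qed

text \<open>By detailed balance the drift over time \<open>h\<close> is \<open>o(h)\<close>.
  Subadditivity bounds the drift over \<open>t\<close> by \<open>n\<close> times the drift over
  \<open>t / n\<close>, which tends to 0.\<close>

lemma reversible_imp_stationary:
  assumes tf: "transition_function_with_rates S r P"
    and balance: "\<And>x y. x \<in> S \<Longrightarrow> y \<in> S \<Longrightarrow> x \<noteq> y \<Longrightarrow> \<pi> x * r x y = \<pi> y * r y x"
    and "0 \<le> t" "z \<in> S"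
  shows "(\<Sum>x\<in>S. \<pi> x * P t x z) = \<pi> z"
proof (cases "t = 0")
  case True
  have "finite S" using tf unfolding transition_function_with_rates_def by simp
  have "(\<Sum>x\<in>S. \<pi> x * P t x z) = (\<Sum>x\<in>S. if x = z then \<pi> z else 0)"
    using transition_function_zero[OF tf _ \<open>z \<in> S\<close>] True by (intro sum.cong) auto
  then show ?thesis using \<open>finite S\<close> \<open>z \<in> S\<close> by simp
next
  case False
  with \<open>0 \<le> t\<close> have t: "0 < t" by simp
  have fin: "finite S" using tf unfolding transition_function_with_rates_def by simp
  \<comment> \<open>\<open>r\<close> prescribes only off-diagonal limits; the row sums eliminate the
    diagonal entry \<open>P h z z\<close>.\<close>
  have drift: "(\<Sum>x\<in>S. \<pi> x * P h x z) - \<pi> z = (\<Sum>x\<in>S - {z}. \<pi> x * P h x z - \<pi> z * P h z x)"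
    if "0 \<le> h" "z \<in> S" for h z
  proof -
    have "\<pi> z = (\<Sum>x\<in>S. \<pi> z * P h z x)"
      using transition_function_sum[OF tf that] by (simp add: sum_distrib_left[symmetric])
    then have "(\<Sum>x\<in>S. \<pi> x * P h x z) - \<pi> z = (\<Sum>x\<in>S. \<pi> x * P h x z - \<pi> z * P h z x)"
      by (simp add: sum_subtractf)
    then show ?thesis
      using fin that(2) by (simp add: sum.remove)
  qed
  have "((\<lambda>h. \<Sum>z\<in>S. \<bar>\<Sum>x\<in>S - {z}. \<pi> x * (P h x z / h) - \<pi> z * (P h z x / h)\<bar>) \<longlongrightarrow>
      (\<Sum>z\<in>S. \<bar>\<Sum>x\<in>S - {z}. \<pi> x * r x z - \<pi> z * r z x\<bar>)) (at_right 0)"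
    by (intro tendsto_intros transition_function_offdiag_limit[OF tf]) auto
  also have "(\<Sum>z\<in>S. \<bar>\<Sum>x\<in>S - {z}. \<pi> x * r x z - \<pi> z * r z x\<bar>) = 0"
    using balance by (simp add: sum.neutral)
  finally have "((\<lambda>h. l1_drift S \<pi> P h / h) \<longlongrightarrow> 0) (at_right 0)"
  proof (rule Lim_transform_eventually)
    show "\<forall>\<^sub>F h in at_right 0. (\<Sum>z\<in>S. \<bar>\<Sum>x\<in>S - {z}. \<pi> x * (P h x z / h) - \<pi> z * (P h z x / h)\<bar>)
        = l1_drift S \<pi> P h / h"
      using eventually_at_right_less[of 0]
    proof eventually_elim
      case (elim h)
      have "l1_drift S \<pi> P h / h = (\<Sum>z\<in>S. \<bar>\<Sum>x\<in>S - {z}. \<pi> x * P h x z - \<pi> z * P h z x\<bar> / h)"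
        using elim by (simp add: l1_drift_def drift sum_divide_distrib)
      also have "\<dots> = (\<Sum>z\<in>S. \<bar>(\<Sum>x\<in>S - {z}. \<pi> x * P h x z - \<pi> z * P h z x) / h\<bar>)"
        using elim by simp
      finally show ?case by (simp add: sum_divide_distrib diff_divide_distrib)
    qed
  qed
  from filterlim_compose[OF this filterlim_divide_nat[OF t]]
  have "(\<lambda>n. l1_drift S \<pi> P (t / real n) / (t / real n)) \<longlonglongrightarrow> 0" .
  then have lim: "(\<lambda>n. t * (l1_drift S \<pi> P (t / real n) / (t / real n))) \<longlonglongrightarrow> 0"
    by (rule tendsto_mult_right_zero)
  have iter: "l1_drift S \<pi> P (real n * h) \<le> real n * l1_drift S \<pi> P h" if "0 < h" for n h
  proof (induction n)
    case 0
    have "l1_drift S \<pi> P 0 = (\<Sum>z\<in>S. \<bar>(\<Sum>x\<in>S. if x = z then \<pi> z else 0) - \<pi> z\<bar>)"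
      unfolding l1_drift_def
      by (intro sum.cong arg_cong[where f = abs] arg_cong2[where f = minus])
         (auto simp: transition_function_zero[OF tf])
    then show ?case using fin by simp
  next
    case (Suc n)
    have "l1_drift S \<pi> P (real (Suc n) * h) = l1_drift S \<pi> P (real n * h + h)"
      by (simp add: algebra_simps)
    also have "\<dots> \<le> l1_drift S \<pi> P (real n * h) + l1_drift S \<pi> P h"
      using that by (intro l1_drift_add[OF tf]) auto
    finally show ?case using Suc by (simp add: algebra_simps)
  qed
  have "l1_drift S \<pi> P t \<le> 0"
  proof (rule tendsto_lowerbound[OF lim])
    show "\<forall>\<^sub>F n in sequentially. l1_drift S \<pi> P t \<le> t * (l1_drift S \<pi> P (t / real n) / (t / real n))"
      using eventually_gt_at_top[of 0]
    proof eventually_elim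
      case (elim n)
      then show ?case using iter[of "t / real n" n] t by (simp add: mult.commute)
    qed
  qed simp
  then have "l1_drift S \<pi> P t = 0"
    by (intro antisym) (simp_all add: l1_drift_def sum_nonneg)
  then show ?thesis
    using fin \<open>z \<in> S\<close> by (simp add: l1_drift_def sum_nonneg_eq_0_iff)
qed

section \<open>Hitting times through time discretisation\<close>

lemma markov_jump_process_transition:
  assumes "markov_jump_process S r x0 M X"
  obtains P where "transition_function_with_rates S r P"
    and "\<And>s u x y. 0 \<le> s \<Longrightarrow> s < u \<Longrightarrow> x \<in> S \<Longrightarrow> y \<in> S \<Longrightarrow>
      measure M {\<omega> \<in> space M. X s \<omega> = x \<and> X u \<omega> = y}
        = measure M {\<omega> \<in> space M. X s \<omega> = x} * P (u - s) x y"
proof -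
  obtain P where tf: "transition_function_with_rates S r P"
    and markov: "\<And>(n::nat) t x. 0 \<le> t 0 \<longrightarrow> (\<forall>k\<le>n. t k < t (Suc k)) \<longrightarrow> (\<forall>k\<le>Suc n. x k \<in> S) \<longrightarrow>
           measure M {\<omega> \<in> space M. \<forall>k\<le>Suc n. X (t k) \<omega> = x k} =
           measure M {\<omega> \<in> space M. \<forall>k\<le>n. X (t k) \<omega> = x k} *
             P (t (Suc n) - t n) (x n) (x (Suc n))"
    using assms unfolding markov_jump_process_def by blast
  \<comment> \<open>The Markov property is applied with \<open>n = 0\<close>, which gives the joint
    law at two times.\<close>
  have two: "(\<forall>k\<le>Suc 0. Q k) \<longleftrightarrow> Q 0 \<and> Q (Suc 0)" for Q :: "nat \<Rightarrow> bool"
    by (auto simp: le_Suc_eq)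
  show thesis
  proof (rule that[OF tf])
    fix s u x y
    assume "(0::real) \<le> s" "s < u" "x \<in> S" "y \<in> S"
    then show "measure M {\<omega> \<in> space M. X s \<omega> = x \<and> X u \<omega> = y}
        = measure M {\<omega> \<in> space M. X s \<omega> = x} * P (u - s) x y"
      using markov[of "\<lambda>k. if k = 0 then s else u" 0 "\<lambda>k. if k = 0 then x else y"]
      unfolding two by simp
  qed
qed

text \<open>By right-continuity the path stays at \<open>y\<close> for a while after visiting it, so
  every sufficiently fine grid of \<open>[0, t]\<close> sees the visit. This reduces early hitting
  to events at finitely many times.\<close>

lemma hitting_time_less_imp_grid_visits:
  assumes rc: "\<And>s. 0 \<le> s \<Longrightarrow> \<forall>\<^sub>F u in at_right s. X u \<omega> = X s \<omega>"
    and "hitting_time X y \<omega> < ennreal t"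
  shows "\<exists>N. \<forall>n\<ge>N. \<exists>k\<le>n. X (real k * (t / real n)) \<omega> = y"
proof -
  obtain s where s: "0 < s" "X s \<omega> = y" "ennreal s < ennreal t"
    using assms(2) unfolding hitting_time_def by (auto simp: INF_less_iff)
  then have "s < t" by (simp add: ennreal_less_iff)
  obtain d where "s < d" and d: "\<And>u. s < u \<Longrightarrow> u < d \<Longrightarrow> X u \<omega> = y"
    using rc[of s] s unfolding eventually_at_right_field by auto
  \<comment> \<open>On \<open>[s, s + e)\<close> the path is at \<open>y\<close> and the time is
    below \<open>t\<close>; any mesh smaller than \<open>e\<close> puts a grid point there.\<close>
  define e where "e = min d t - s"
  have e: "0 < e" using \<open>s < d\<close> \<open>s < t\<close> by (simp add: e_def)
  obtain N :: nat where N: "t / e < real N" using reals_Archimedean2 by blast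
  have "\<exists>k\<le>n. X (real k * (t / real n)) \<omega> = y" if "N \<le> n" for n
  proof -
    have tn: "t / e < real n" using N that by linarith
    have t: "0 < t" using s \<open>s < t\<close> by simp
    then have n: "0 < real n" using tn e by (smt (verit) divide_pos_pos)
    define h where "h = t / real n"
    have h: "0 < h" using t n by (simp add: h_def)
    have "h < e" using tn e n by (simp add: h_def field_simps)
    \<comment> \<open>The first grid point at or after \<open>s\<close>, less than one mesh width
      beyond it.\<close>
    define k where "k = nat \<lceil>s / h\<rceil>"
    have "real k = of_int \<lceil>s / h\<rceil>"
      using s h by (simp add: k_def)
    then have "s / h \<le> real k" "real k < s / h + 1"
      by linarith+
    then have k: "s \<le> real k * h" "real k * h < s + h"
      using h by (simp_all add: field_simps)
    have "real k * h < real n * h"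
      using k(2) \<open>h < e\<close> n by (simp add: h_def e_def)
    then have "k \<le> n" using h by simp
    moreover have "X (real k * h) \<omega> = y"
      using k d[of "real k * h"] s(2) \<open>h < e\<close> by (cases "s = real k * h") (auto simp: e_def)
    ultimately show ?thesis unfolding h_def by blast
  qed
  then show ?thesis by blast
qed

lemma ex_crossing:
  assumes "Q (0::nat)" "\<not> Q n"
  shows "\<exists>k<n. Q k \<and> \<not> Q (Suc k)"
  using assms by (induction n) (auto simp: less_Suc_eq)

text \<open>A path seen at \<open>y\<close> must pass from \<open>A\<close> to \<open>S - A\<close>
  between two consecutive grid points. The union bound runs over the \<open>n\<close> steps and all
  pairs of states, and the law at each grid time is at most \<open>\<pi> / \<pi> x0\<close>.\<close>

lemma markov_jump_process_grid_visit_prob: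
  assumes mjp: "markov_jump_process S r x0 M X"
    and tf: "transition_function_with_rates S r P"
    and joint: "\<And>s u x y. 0 \<le> s \<Longrightarrow> s < u \<Longrightarrow> x \<in> S \<Longrightarrow> y \<in> S \<Longrightarrow>
      measure M {\<omega> \<in> space M. X s \<omega> = x \<and> X u \<omega> = y}
        = measure M {\<omega> \<in> space M. X s \<omega> = x} * P (u - s) x y"
    and pos: "\<And>x. x \<in> S \<Longrightarrow> 0 < \<pi> x"
    and balance: "\<And>x y. x \<in> S \<Longrightarrow> y \<in> S \<Longrightarrow> x \<noteq> y \<Longrightarrow> \<pi> x * r x y = \<pi> y * r y x"
    and A: "x0 \<in> A" "A \<subseteq> S" "y \<in> S - A" and "0 < h"
  shows "measure M {\<omega> \<in> space M. \<exists>k\<le>n. X (real k * h) \<omega> = y}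
    \<le> real n * (\<Sum>a\<in>A. \<Sum>b\<in>S - A. \<pi> a / \<pi> x0 * P h a b)"
proof -
  interpret prob_space M using mjp unfolding markov_jump_process_def by simp
  have fin: "finite S" using tf unfolding transition_function_with_rates_def by simp
  have meas: "X t \<in> measurable M (count_space S)" if "0 \<le> t" for t
    using mjp that unfolding markov_jump_process_def by simp
  have ev: "{\<omega> \<in> space M. X t \<omega> = x} \<in> sets M" if "0 \<le> t" "x \<in> S" for t x
  proof -
    have "X t -` {x} \<inter> space M \<in> sets M"
      using measurable_sets[OF meas[OF that(1)], of "{x}"] that(2) by simp
    then show ?thesis by (simp add: vimage_def Int_def conj_commute)
  qed
  have ev2: "{\<omega> \<in> space M. X s \<omega> = a \<and> X t \<omega> = b} \<in> sets M"
    if "0 \<le> s" "0 \<le> t" "a \<in> S" "b \<in> S" for s t a b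
    using sets.Int[OF ev[OF that(1,3)] ev[OF that(2,4)]] by (simp add: Int_def conj_ac cong: conj_cong)
  have X0: "AE \<omega> in M. X 0 \<omega> = x0"
    using mjp unfolding markov_jump_process_def by simp
  have x0: "x0 \<in> S" using A by auto
  have marginal: "measure M {\<omega> \<in> space M. X t \<omega> = a} \<le> \<pi> a / \<pi> x0" if "0 \<le> t" "a \<in> S" for t a
  proof -
    have "measure M {\<omega> \<in> space M. X t \<omega> = a} = P t x0 a"
    proof (cases "t = 0")
      case True
      have "measure M {\<omega> \<in> space M. X 0 \<omega> = a} = (if a = x0 then 1 else 0)"
      proof (cases "a = x0")
        case True
        then show ?thesis using prob_Collect_eq_1[OF ev[of 0 x0]] X0 x0 by simp
      next
        case False
        then show ?thesis using prob_Collect_eq_0[OF ev[of 0 a]] X0 that by auto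
      qed
      then show ?thesis
        using True transition_function_zero[OF tf x0 \<open>a \<in> S\<close>] by auto
    next
      case False
      with that have t: "0 < t" by simp
      have "measure M {\<omega> \<in> space M. X t \<omega> = a} = measure M {\<omega> \<in> space M. X 0 \<omega> = x0 \<and> X t \<omega> = a}"
        using X0 that x0 by (intro finite_measure_eq_AE ev ev2) auto
      also have "\<dots> = measure M {\<omega> \<in> space M. X 0 \<omega> = x0} * P t x0 a"
        using joint[of 0 t x0 a] t x0 that by simp
      also have "measure M {\<omega> \<in> space M. X 0 \<omega> = x0} = 1"
        using prob_Collect_eq_1[OF ev[of 0 x0]] X0 x0 by simp
      finally show ?thesis by simp
    qed
    \<comment> \<open>One term of the stationarity sum, whose value is
      \<open>\<pi> a\<close>.\<close>
    moreover have "\<pi> x0 * P t x0 a \<le> (\<Sum>x\<in>S. \<pi> x * P t x a)"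
      using fin x0 pos transition_function_nonneg[OF tf that(1) _ that(2)]
      by (intro member_le_sum) (auto intro!: mult_nonneg_nonneg pos[THEN less_imp_le])
    ultimately show ?thesis
      using reversible_imp_stationary[OF tf balance that] pos[OF x0]
      by (simp add: field_simps)
  qed
  define C where "C = (\<lambda>(k, a, b). {\<omega> \<in> space M. X (real k * h) \<omega> = a \<and> X (real (Suc k) * h) \<omega> = b})"
  let ?I = "{..<n} \<times> A \<times> (S - A)"
  have finI: "finite ?I"
    using fin A by (auto intro: finite_subset)
  have C: "C i \<in> sets M" if "i \<in> ?I" for i
    using that A \<open>0 < h\<close> unfolding C_def by (auto intro!: ev2)
  have "measure M {\<omega> \<in> space M. \<exists>k\<le>n. X (real k * h) \<omega> = y} \<le> measure M (\<Union>i\<in>?I. C i)"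
  proof (rule finite_measure_mono_AE)
    show "(\<Union>i\<in>?I. C i) \<in> sets M"
      using finI C by (intro sets.finite_UN) auto
    show "AE \<omega> in M. \<omega> \<in> {\<omega> \<in> space M. \<exists>k\<le>n. X (real k * h) \<omega> = y} \<longrightarrow> \<omega> \<in> (\<Union>i\<in>?I. C i)"
      using X0
    proof eventually_elim
      case (elim \<omega>)
      show ?case
      proof
        assume "\<omega> \<in> {\<omega> \<in> space M. \<exists>k\<le>n. X (real k * h) \<omega> = y}"
        then obtain k where k: "\<omega> \<in> space M" "k \<le> n" "X (real k * h) \<omega> = y" by blast
        obtain l where l: "l < k" "X (real l * h) \<omega> \<in> A" "X (real (Suc l) * h) \<omega> \<notin> A"
          using ex_crossing[of "\<lambda>k. X (real k * h) \<omega> \<in> A" k] elim A k by auto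
        moreover have "X (real (Suc l) * h) \<omega> \<in> S"
          using measurable_space[OF meas k(1), of "real (Suc l) * h"] \<open>0 < h\<close> by simp
        ultimately show "\<omega> \<in> (\<Union>i\<in>?I. C i)"
          using k unfolding C_def
          by (intro UN_I[of "(l, X (real l * h) \<omega>, X (real (Suc l) * h) \<omega>)"]) auto
      qed
    qed
  qed
  also have "\<dots> \<le> (\<Sum>i\<in>?I. measure M (C i))"
    using finI C by (intro finite_measure_subadditive_finite) auto
  also have "\<dots> \<le> (\<Sum>(k, a, b)\<in>?I. \<pi> a / \<pi> x0 * P h a b)"
  proof (rule sum_mono)
    fix i assume "i \<in> ?I"
    then obtain k a b where i: "i = (k, a, b)" "k < n" "a \<in> A" "b \<in> S" by auto
    then have "measure M (C i) = measure M {\<omega> \<in> space M. X (real k * h) \<omega> = a} * P h a b"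
      using joint[of "real k * h" "real (Suc k) * h" a b] A \<open>0 < h\<close>
      by (auto simp: C_def algebra_simps)
    also have "\<dots> \<le> \<pi> a / \<pi> x0 * P h a b"
      using i A \<open>0 < h\<close> by (intro mult_right_mono marginal transition_function_nonneg[OF tf]) auto
    finally show "measure M (C i) \<le> (case i of (k, a, b) \<Rightarrow> \<pi> a / \<pi> x0 * P h a b)"
      using i by simp
  qed
  also have "\<dots> = real n * (\<Sum>a\<in>A. \<Sum>b\<in>S - A. \<pi> a / \<pi> x0 * P h a b)"
    by (simp add: sum.cartesian_product[symmetric])
  finally show ?thesis .
qed

text \<open>As the grid is refined, the visit bound tends to \<open>t\<close> times the equilibrium
  flow out of \<open>A\<close> divided by \<open>\<pi> x0\<close>, hence to at most
  \<open>t * K\<close>. The choice \<open>t = 1 / (2 * K)\<close> makes this 1/2, so the hitting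
  time is at least \<open>t\<close> with probability at least 1/2.\<close>

lemma reversible_hitting_time_lower_bound:
  assumes mjp: "markov_jump_process S r x0 M X"
    and pos: "\<And>x. x \<in> S \<Longrightarrow> 0 < \<pi> x"
    and balance: "\<And>x y. x \<in> S \<Longrightarrow> y \<in> S \<Longrightarrow> x \<noteq> y \<Longrightarrow> \<pi> x * r x y = \<pi> y * r y x"
    and A: "x0 \<in> A" "A \<subseteq> S" "y \<in> S - A"
    and K: "0 < K" "(\<Sum>a\<in>A. \<Sum>b\<in>S - A. \<pi> a * r a b) \<le> K * \<pi> x0"
  shows "ennreal (1 / (4 * K)) \<le> (\<integral>\<^sup>+\<omega>. hitting_time X y \<omega> \<partial>M)"
proof -
  interpret prob_space M using mjp unfolding markov_jump_process_def by simp
  obtain P where tf: "transition_function_with_rates S r P"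
    and joint: "\<And>s u x y. 0 \<le> s \<Longrightarrow> s < u \<Longrightarrow> x \<in> S \<Longrightarrow> y \<in> S \<Longrightarrow>
      measure M {\<omega> \<in> space M. X s \<omega> = x \<and> X u \<omega> = y}
        = measure M {\<omega> \<in> space M. X s \<omega> = x} * P (u - s) x y"
    using markov_jump_process_transition[OF mjp] by blast
  have "0 < \<pi> x0" using pos A by auto
  define t where "t = 1 / (2 * K)"
  have t: "0 < t" using K by (simp add: t_def)
  define B where "B n = {\<omega> \<in> space M. \<exists>k\<le>n. X (real k * (t / real n)) \<omega> = y}" for n
  have B: "B n \<in> sets M" for n
  proof -
    have "{\<omega> \<in> space M. X u \<omega> = y} \<in> sets M" if "0 \<le> u" for u
    proof -
      have "X u \<in> measurable M (count_space S)"
        using mjp that unfolding markov_jump_process_def by simp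
      from measurable_sets[OF this, of "{y}"] A show ?thesis
        by (simp add: vimage_def Int_def conj_commute)
    qed
    then have "(\<Union>k\<in>{..n}. {\<omega> \<in> space M. X (real k * (t / real n)) \<omega> = y}) \<in> sets M"
      using t by (intro sets.finite_UN) auto
    moreover have "(\<Union>k\<in>{..n}. {\<omega> \<in> space M. X (real k * (t / real n)) \<omega> = y}) = B n"
      unfolding B_def by auto
    ultimately show ?thesis by simp
  qed
  define q where "q n = real n * (\<Sum>a\<in>A. \<Sum>b\<in>S - A. \<pi> a / \<pi> x0 * P (t / real n) a b)" for n
  have Bq: "measure M (B n) \<le> q n" if "0 < n" for n
    using markov_jump_process_grid_visit_prob[OF mjp tf joint pos balance A, of "t / real n" n] t that
    unfolding B_def q_def by simp
  have "(\<lambda>n. t / \<pi> x0 * (\<Sum>a\<in>A. \<Sum>b\<in>S - A. \<pi> a * (P (t / real n) a b / (t / real n))))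
      \<longlonglongrightarrow> t / \<pi> x0 * (\<Sum>a\<in>A. \<Sum>b\<in>S - A. \<pi> a * r a b)"
    using A by (intro tendsto_intros
        filterlim_compose[OF transition_function_offdiag_limit[OF tf] filterlim_divide_nat[OF t]]) auto
  then have q: "q \<longlonglongrightarrow> t / \<pi> x0 * (\<Sum>a\<in>A. \<Sum>b\<in>S - A. \<pi> a * r a b)"
  proof (rule Lim_transform_eventually)
    show "\<forall>\<^sub>F n in sequentially.
        t / \<pi> x0 * (\<Sum>a\<in>A. \<Sum>b\<in>S - A. \<pi> a * (P (t / real n) a b / (t / real n))) = q n"
      using eventually_gt_at_top[of 0]
      by eventually_elim (use t \<open>0 < \<pi> x0\<close> in \<open>simp add: q_def sum_distrib_left field_simps\<close>)
  qed
  have "t / \<pi> x0 * (\<Sum>a\<in>A. \<Sum>b\<in>S - A. \<pi> a * r a b) \<le> t / \<pi> x0 * (K * \<pi> x0)"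
    using K t \<open>0 < \<pi> x0\<close> by (intro mult_left_mono) auto
  also have "\<dots> = 1 / 2"
    using K \<open>0 < \<pi> x0\<close> by (simp add: t_def)
  finally have half: "t / \<pi> x0 * (\<Sum>a\<in>A. \<Sum>b\<in>S - A. \<pi> a * r a b) \<le> 1 / 2" .
  \<comment> \<open>\<open>C N\<close> is the event that all grids with at least \<open>N\<close>
    steps see \<open>y\<close>. It increases with \<open>N\<close>, and its union contains almost
    every path that hits \<open>y\<close> before \<open>t\<close>.\<close>
  define C where "C N = (\<Inter>n\<in>{N..}. B n)" for N
  have C: "range C \<subseteq> sets M"
    unfolding C_def using B by (auto intro!: sets.countable_INT')
  have incC: "incseq C"
    unfolding C_def incseq_def by (auto intro!: INT_anti_mono)
  have C_le: "measure M (C N) \<le> 1 / 2" for N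
  proof -
    have "measure M (C N) \<le> t / \<pi> x0 * (\<Sum>a\<in>A. \<Sum>b\<in>S - A. \<pi> a * r a b)"
    proof (rule tendsto_lowerbound[OF q])
      show "\<forall>\<^sub>F n in sequentially. measure M (C N) \<le> q n"
        using eventually_gt_at_top[of N]
      proof eventually_elim
        case (elim n)
        have "measure M (C N) \<le> measure M (B n)"
          using elim B by (intro finite_measure_mono) (auto simp: C_def)
        also have "\<dots> \<le> q n" using elim by (intro Bq) simp
        finally show ?case .
      qed
    qed simp
    also note half
    finally show ?thesis .
  qed
  let ?D = "\<Union>N. C N"
  have D: "?D \<in> sets M" using C by auto
  have "measure M ?D \<le> 1 / 2"
    by (rule LIMSEQ_le_const2[OF finite_Lim_measure_incseq[OF C incC]]) (use C_le in auto)
  then have "1 / 2 \<le> measure M (space M - ?D)"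
    using prob_compl[OF D] by simp
  then have "ennreal (1 / (4 * K)) \<le> ennreal t * emeasure M (space M - ?D)"
    using t K unfolding emeasure_eq_measure
    by (simp add: ennreal_mult[symmetric] t_def field_simps)
  also have "\<dots> = (\<integral>\<^sup>+\<omega>. ennreal t * indicator (space M - ?D) \<omega> \<partial>M)"
    using D by (simp add: nn_integral_cmult_indicator)
  also have "\<dots> \<le> (\<integral>\<^sup>+\<omega>. hitting_time X y \<omega> \<partial>M)"
  proof (rule nn_integral_mono_AE)
    have "AE \<omega> in M. \<forall>s\<ge>0. \<forall>\<^sub>F u in at_right s. X u \<omega> = X s \<omega>"
      using mjp unfolding markov_jump_process_def by simp
    then show "AE \<omega> in M. ennreal t * indicator (space M - ?D) \<omega> \<le> hitting_time X y \<omega>"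
    proof (eventually_elim)
      case (elim \<omega>)
      show ?case
      proof (cases "\<omega> \<in> space M - ?D")
        case True
        have "\<not> hitting_time X y \<omega> < ennreal t"
        proof
          assume "hitting_time X y \<omega> < ennreal t"
          then obtain N where "\<forall>n\<ge>N. \<exists>k\<le>n. X (real k * (t / real n)) \<omega> = y"
            using hitting_time_less_imp_grid_visits[of X \<omega> y t] elim by blast
          then have "\<omega> \<in> C N" using True unfolding C_def B_def by auto
          with True show False by blast
        qed
        with True show ?thesis by (simp add: not_less)
      qed simp
    qed
  qed
  finally show ?thesis .
qed

section \<open>The well around the even configuration\<close>

text \<open>Vertices are numbered from 1 and residues from 0, hence the shift by one.\<close>

definition config :: "nat \<Rightarrow> vertex set \<Rightarrow> int \<Rightarrow> int \<Rightarrow> bool" where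
  "config L I i j \<longleftrightarrow> (nat (i mod int L) + 1, nat (j mod int L) + 1) \<in> I"

lemma finite_torus_vertices: "finite (torus_vertices L)"
  by (simp add: torus_vertices_def)

lemma finite_independent_sets: "finite (independent_sets L)"
  by (rule finite_subset[of _ "Pow (torus_vertices L)"])
     (auto simp: independent_sets_def finite_torus_vertices)

lemma finite_independent_set: "I \<in> independent_sets L \<Longrightarrow> finite I"
  using finite_torus_vertices[of L] by (auto simp: independent_sets_def intro: finite_subset)

lemma torus_vertex_residue:
  assumes "0 < L"
  shows "(nat (i mod int L) + 1, nat (j mod int L) + 1) \<in> torus_vertices L"
proof -
  have "nat (i mod int L) < L" "nat (j mod int L) < L"
    using assms by (simp_all add: nat_less_iff)
  then show ?thesis unfolding torus_vertices_def by auto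
qed

lemma cyclic_neighbours_residue:
  assumes "0 < L"
  shows "cyclic_neighbours L (nat (i mod int L) + 1) (nat ((i + 1) mod int L) + 1)"
proof -
  have "int (nat ((i + 1) mod int L) + 1) = (i + 1) mod int L + 1"
    "int (nat (i mod int L) + 1 + 1) = i mod int L + 2"
    using assms by simp_all
  then have "[int (nat ((i + 1) mod int L) + 1) = int (nat (i mod int L) + 1 + 1)] (mod int L)"
    by (simp add: cong_def mod_add_left_eq mod_add_right_eq)
  then show ?thesis
    unfolding cyclic_neighbours_def cong_int_iff by blast
qed

lemma hard_core_config:
  assumes "I \<in> independent_sets L" "0 < L"
  shows "hard_core (int L) (config L I)"
  unfolding hard_core_def
proof (intro conjI allI impI)
  show "config L I i j = config L I i' j'" if "[i = i'] (mod int L)" "[j = j'] (mod int L)" for i i' j j'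
    using that by (simp add: config_def cong_def)
  have "torus_adj L (nat (i mod int L) + 1, nat (j mod int L) + 1) (nat ((i + 1) mod int L) + 1, nat (j mod int L) + 1)"
    "torus_adj L (nat (i mod int L) + 1, nat (j mod int L) + 1) (nat (i mod int L) + 1, nat ((j + 1) mod int L) + 1)"
    for i j
    using torus_vertex_residue cyclic_neighbours_residue assms(2) by (simp_all add: torus_adj_def)
  then show "\<not> config L I (i + 1) j" "\<not> config L I i (j + 1)" if "config L I i j" for i j
    using that assms(1) unfolding independent_sets_def config_def by blast+
qed

lemma weight_config:
  assumes "I \<subseteq> torus_vertices L"
  shows "weight (int L) (config L I) = int (card I)"
proof -
  let ?g = "\<lambda>(i, j). (nat i + 1, nat j + 1)"
  have "weight (int L) (config L I)
      = (\<Sum>x\<in>{0..<int L} \<times> {0..<int L}. of_bool (?g x \<in> I))"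
    unfolding weight_def sum.cartesian_product by (intro sum.cong) (auto simp: config_def)
  also have "\<dots> = (\<Sum>y\<in>torus_vertices L. of_bool (y \<in> I))"
    by (rule sum.reindex_bij_witness[where j = "?g" and i = "\<lambda>(a, b). (int a - 1, int b - 1)"])
       (auto simp: torus_vertices_def)
  also have "\<dots> = int (card I)"
    using assms finite_torus_vertices[of L]
    by (simp add: of_bool_def sum.If_cases Int_absorb1 Collect_mem_eq flip: Int_def)
  finally show ?thesis .
qed

lemma config_insert:
  assumes "0 < L" "config L (insert v I) i j"
  shows "config L I i j \<or> [i = int (fst v) - 1] (mod int L) \<and> [j = int (snd v) - 1] (mod int L)"
  using assms by (auto simp: config_def cong_def)

lemma config_vertex:
  assumes "v \<in> torus_vertices L"
  shows "config L I (int (fst v) - 1) (int (snd v) - 1) \<longleftrightarrow> v \<in> I"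
proof -
  have "(int (fst v) - 1) mod int L = int (fst v) - 1" "(int (snd v) - 1) mod int L = int (snd v) - 1"
    using assms by (auto simp: torus_vertices_def)
  then show ?thesis
    using assms by (auto simp: config_def torus_vertices_def nat_diff_distrib')
qed

lemma even_residue:
  assumes "even L" "0 < L"
  shows "even ((nat (i mod int L) + 1) + (nat (j mod int L) + 1)) \<longleftrightarrow> even (i + j)"
proof -
  have "even (i mod int L) = even i" "even (j mod int L) = even j"
    using assms(1) by (simp_all add: dvd_mod_iff)
  then show ?thesis
    using assms(2) by (simp add: even_nat_iff)
qed

section \<open>The well and its boundary\<close>

text \<open>The size condition is |I| \<ge> L^2/2 - L + 1, doubled and over the integers to avoid
  division and truncated subtraction. At this size all filled row strips have the same parity, by
  \<open>filled_unique\<close>.\<close>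

definition even_core :: "nat \<Rightarrow> vertex set set" where
  "even_core L = {I \<in> independent_sets L.
     int L * int L - 2 * int L + 2 \<le> 2 * int (card I) \<and> (\<exists>i. filled (int L) True (config L I) i)}"

text \<open>The added layer of size L^2/2 - L lowers the exit level by one particle, which gains a
  factor \<sigma> in the final bound.\<close>

definition even_well :: "nat \<Rightarrow> vertex set set" where
  "even_well L = even_core L \<union> {I \<in> independent_sets L.
     2 * int (card I) = int L * int L - 2 * int L \<and> (\<exists>v. v \<notin> I \<and> insert v I \<in> even_core L)}"

text \<open>If the smaller set is still above the threshold, it has a filled strip, which stays
  filled when \<open>v\<close> is put back and is therefore even. At the critical size,
  \<open>v\<close> witnesses membership in the added layer.\<close>

lemma even_core_remove:
  assumes "even L" "4 \<le> L" "insert v I \<in> even_core L" "v \<notin> I" "I \<in> independent_sets L"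
  shows "I \<in> even_well L \<or> 2 * card I < L * L - 2 * L"
proof -
  have card: "card (insert v I) = card I + 1"
    using finite_independent_set[OF assms(5)] assms(4) by simp
  have hc: "hard_core (int L) (config L I)" "hard_core (int L) (config L (insert v I))"
    using assms by (auto intro: hard_core_config simp: even_core_def)
  have w: "weight (int L) (config L I) = int (card I)"
    "weight (int L) (config L (insert v I)) = int (card (insert v I))"
    using assms by (auto intro!: weight_config simp: even_core_def independent_sets_def)
  \<comment> \<open>Evenness excludes the value \<open>2 * m + 1\<close> for twice the cardinality,
    so three cases remain.\<close>
  have "even (int L * int L - 2 * int L)" using assms(1) by simp
  then obtain m where m: "int L * int L - 2 * int L = 2 * m" by (elim evenE)
  have "2 * m + 2 \<le> 2 * int (card I) \<or> 2 * int (card I) = 2 * m \<or> 2 * int (card I) < 2 * m"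
    by presburger
  then consider "int L * int L - 2 * int L + 2 \<le> 2 * int (card I)"
    | "2 * int (card I) = int L * int L - 2 * int L"
    | "2 * int (card I) < int L * int L - 2 * int L"
    unfolding m by blast
  then show ?thesis
  proof cases
    case 1
    then obtain i b where ib: "filled (int L) b (config L I) i"
      using ex_filled[OF hc(1)] assms(1,2) w by auto
    then have "filled (int L) b (config L (insert v I)) i"
      by (rule filled_mono) (auto simp: config_def)
    moreover obtain i' where "filled (int L) True (config L (insert v I)) i'"
      using assms(3) by (auto simp: even_core_def)
    ultimately have "b = True"
      using filled_unique[OF hc(2), of b i True i'] assms(1,2) w card 1 by simp
    with ib 1 assms(5) show ?thesis
      by (auto simp: even_well_def even_core_def)
  next
    case 2
    then show ?thesis using assms(3-5) unfolding even_well_def by blast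
  next
    case 3
    then have "2 * int (card I) < int (L * L) - int (2 * L)" by simp
    then show ?thesis by linarith
  qed
qed

text \<open>The core is closed under additions because filled strips stay filled. In the added layer
  some completion by \<open>v\<close> is even, and \<open>added_particles_same_type\<close>
  transfers this to the completion by \<open>w\<close>.\<close>

lemma even_well_add:
  assumes "even L" "4 \<le> L" "I \<in> even_well L" "w \<notin> I" "insert w I \<in> independent_sets L"
  shows "insert w I \<in> even_well L"
proof -
  have I: "I \<in> independent_sets L" using assms(3) by (auto simp: even_well_def even_core_def)
  have card: "card (insert v I) = card I + 1" if "v \<notin> I" for v
    using finite_independent_set[OF I] that by simp
  show ?thesis
  proof (cases "I \<in> even_core L")
    case True
    then obtain i where "filled (int L) True (config L I) i" by (auto simp: even_core_def)
    then have "filled (int L) True (config L (insert w I)) i"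
      by (rule filled_mono) (auto simp: config_def)
    with True show ?thesis
      using assms(5) card[OF assms(4)] by (auto simp: even_well_def even_core_def)
  next
    case False
    then obtain v where v: "2 * int (card I) = int L * int L - 2 * int L" "v \<notin> I"
      "insert v I \<in> even_core L"
      using assms(3) by (auto simp: even_well_def)
    obtain i where i: "filled (int L) True (config L (insert v I)) i"
      using v(3) by (auto simp: even_core_def)
    have vI: "insert v I \<in> independent_sets L" using v(3) by (simp add: even_core_def)
    have vt: "v \<in> torus_vertices L" "w \<in> torus_vertices L" "I \<subseteq> torus_vertices L"
      using vI assms(5) by (auto simp: independent_sets_def)
    have hc: "hard_core (int L) (config L I)" "hard_core (int L) (config L (insert v I))"
      "hard_core (int L) (config L (insert w I))"
      using assms(2,5) I vI by (auto intro: hard_core_config)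
    have weights: "weight (int L) (config L I) = int (card I)"
      "weight (int L) (config L (insert v I)) = int (card I) + 1"
      "weight (int L) (config L (insert w I)) = int (card I) + 1"
      using vt weight_config[of _ L] card[OF v(2)] card[OF assms(4)] by simp_all
    obtain i' b where i': "filled (int L) b (config L (insert w I)) i'"
      using ex_filled[OF hc(3)] assms(1,2) weights v(1) by auto
    have L0: "0 < L" using assms(2) by simp
    have "True = b"
    proof (rule added_particles_same_type[OF hc, where r = "int (fst v) - 1" and c = "int (snd v) - 1"
          and r' = "int (fst w) - 1" and c' = "int (snd w) - 1" and ?i0.0 = i and i0' = i'])
      show "\<not> config L I (int (fst v) - 1) (int (snd v) - 1)"
        "config L (insert v I) (int (fst v) - 1) (int (snd v) - 1)"
        "\<not> config L I (int (fst w) - 1) (int (snd w) - 1)"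
        "config L (insert w I) (int (fst w) - 1) (int (snd w) - 1)"
        using v(2) assms(4) by (simp_all add: config_vertex vt)
      show "even (int L)" "4 \<le> int L" using assms(1,2) by simp_all
      show "2 * weight (int L) (config L I) = int L * int L - 2 * int L"
        "int L * int L - 2 * int L + 2 \<le> 2 * weight (int L) (config L (insert v I))"
        "int L * int L - 2 * int L + 2 \<le> 2 * weight (int L) (config L (insert w I))"
        unfolding weights using v(1) by simp_all
      show "config L (insert v I) i j" "config L (insert w I) i j" if "config L I i j" for i j
        using that by (simp_all add: config_def)
    qed (fact i i' config_insert[OF L0])+
    with i' show ?thesis
      using assms(5) card[OF assms(4)] v(1) by (auto simp: even_well_def even_core_def)
  qed
qed

lemma even_odd_vertices_independent:
  assumes "even L"
  shows "even_vertices L \<in> independent_sets L" "odd_vertices L \<in> independent_sets L"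
proof -
  have parity: "even a \<noteq> even b" if "cyclic_neighbours L a b" for a b
  proof -
    have "even c = even d" if "[c = d] (mod L)" for c d
      using cong_dvd_iff[OF cong_dvd_modulus_nat[OF that assms]] .
    then have "even a = even (b + 1) \<or> even b = even (a + 1)"
      using that unfolding cyclic_neighbours_def by blast
    then show ?thesis by auto
  qed
  have "even (fst u + snd u) \<noteq> even (fst v + snd v)" if "torus_adj L u v" for u v
    using that unfolding torus_adj_def by (auto dest: parity)
  then show "even_vertices L \<in> independent_sets L" "odd_vertices L \<in> independent_sets L"
    unfolding independent_sets_def even_vertices_def odd_vertices_def by blast+
qed

lemma config_even_odd_vertices:
  assumes "even L" "0 < L"
  shows "config L (even_vertices L) i j \<longleftrightarrow> even (i + j)"
    "config L (odd_vertices L) i j \<longleftrightarrow> odd (i + j)"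
  using torus_vertex_residue[OF assms(2), of i j] even_residue[OF assms, of i j]
  unfolding config_def even_vertices_def odd_vertices_def mem_Collect_eq fst_conv snd_conv
  by blast+

text \<open>Every strip has exactly one particle per column, so the sizes follow from
  \<open>sum_strip_weight\<close>.\<close>

lemma card_even_odd_vertices:
  assumes "even L" "0 < L"
  shows "2 * card (even_vertices L) = L * L" "2 * card (odd_vertices L) = L * L"
proof -
  have *: "2 * card I = L * L"
    if I: "I \<in> independent_sets L" and cf: "\<And>i j. config L I i j \<longleftrightarrow> even (i + j) = b" for I b
  proof -
    have "strip_weight (int L) (config L I) i = int L" for i
    proof -
      have "of_bool (config L I i j) + of_bool (config L I (i + 1) j) = (1::int)" for j
        unfolding cf by (cases b) auto
      then show ?thesis unfolding strip_weight_def by simp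
    qed
    then have "2 * weight (int L) (config L I) = int L * int L"
      using sum_strip_weight[OF hard_core_config[OF I assms(2)]] assms(2) by simp
    then have "int (2 * card I) = int (L * L)"
      using weight_config[of I L] I by (simp add: independent_sets_def)
    then show ?thesis by (simp only: of_nat_eq_iff)
  qed
  show "2 * card (even_vertices L) = L * L" "2 * card (odd_vertices L) = L * L"
    using *[of "even_vertices L" True] *[of "odd_vertices L" False]
    by (simp_all add: even_odd_vertices_independent config_even_odd_vertices assms)
qed

lemma even_vertices_in_even_well:
  assumes "even L" "4 \<le> L"
  shows "even_vertices L \<in> even_well L"
proof -
  have "filled (int L) True (config L (even_vertices L)) 0"
    unfolding filled_def using config_even_odd_vertices[of L] assms by auto
  moreover have "2 * card (even_vertices L) = L * L"
    using card_even_odd_vertices(1)[of L] assms by simp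
  then have "int (2 * card (even_vertices L)) = int (L * L)"
    by (rule arg_cong)
  then have "2 * int (card (even_vertices L)) = int L * int L"
    by simp
  ultimately show ?thesis
    using assms even_odd_vertices_independent(1)[of L]
    unfolding even_well_def even_core_def by (intro UnI1 CollectI conjI) auto
qed

text \<open>The size L^2/2 rules out the added layer, and an even filled strip would contain an
  occupied even site.\<close>

lemma odd_vertices_notin_even_well:
  assumes "even L" "4 \<le> L"
  shows "odd_vertices L \<notin> even_well L"
proof
  assume asm: "odd_vertices L \<in> even_well L"
  have "2 * card (odd_vertices L) = L * L"
    using card_even_odd_vertices(2)[of L] assms by simp
  then have "int (2 * card (odd_vertices L)) = int (L * L)"
    by (rule arg_cong)
  with asm assms(2) have "odd_vertices L \<in> even_core L"
    by (auto simp: even_well_def)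
  then obtain i where i: "filled (int L) True (config L (odd_vertices L)) i"
    by (auto simp: even_core_def)
  have "2 \<le> int L" using assms(2) by simp
  then obtain x y where "config L (odd_vertices L) x y" "even (x + y)"
    using filled_block[OF i, of 0] by blast
  then show False
    using config_even_odd_vertices(2)[of L x y] assms by simp
qed

section \<open>The activity process\<close>

lemma activity_rate_insert:
  assumes "v \<notin> I" "insert v I \<in> independent_sets L"
  shows "activity_rate L \<nu> p \<mu> I (insert v I) = \<nu>"
    and "activity_rate L \<nu> p \<mu> (insert v I) I = p * \<mu>"
proof -
  have "\<exists>w. w \<notin> I \<and> insert v I = I \<union> {w} \<and> I \<union> {w} \<in> independent_sets L"
    using assms by (intro exI[of _ v]) simp
  then show "activity_rate L \<nu> p \<mu> I (insert v I) = \<nu>"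
    unfolding activity_rate_def by (simp only: if_True)
  have "\<not> (\<exists>w. w \<notin> insert v I \<and> I = insert v I \<union> {w} \<and> insert v I \<union> {w} \<in> independent_sets L)"
    using assms(1) by blast
  moreover have "\<exists>w\<in>insert v I. I = insert v I - {w}"
    using assms(1) by blast
  ultimately show "activity_rate L \<nu> p \<mu> (insert v I) I = p * \<mu>"
    unfolding activity_rate_def by (simp only: if_False if_True)
qed

lemma activity_rate_nonzero_cases:
  assumes "activity_rate L \<nu> p \<mu> I J \<noteq> 0"
  obtains (add) v where "v \<notin> I" "J = insert v I"
    | (remove) v where "v \<notin> J" "I = insert v J"
proof -
  have "(\<exists>v. v \<notin> I \<and> J = I \<union> {v}) \<or> (\<exists>v\<in>I. J = I - {v})"
    using assms unfolding activity_rate_def by (auto split: if_splits)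
  then show thesis
  proof (elim disjE exE bexE conjE)
    fix v assume "v \<notin> I" "J = I \<union> {v}"
    then show thesis by (intro add[of v]) auto
  next
    fix v assume "v \<in> I" "J = I - {v}"
    then show thesis by (intro remove[of v]) auto
  qed
qed

lemma activity_rate_insert_balance:
  assumes "0 < \<nu>" "0 < p" "0 < \<mu>" "v \<notin> I" "finite I" "insert v I \<in> independent_sets L"
  shows "(\<nu> / (p * \<mu>)) ^ card I * activity_rate L \<nu> p \<mu> I (insert v I)
    = (\<nu> / (p * \<mu>)) ^ card (insert v I) * activity_rate L \<nu> p \<mu> (insert v I) I"
  using assms by (simp add: activity_rate_insert)

lemma activity_rate_balance:
  assumes "0 < \<nu>" "0 < p" "0 < \<mu>" "I \<in> independent_sets L" "J \<in> independent_sets L"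
  shows "(\<nu> / (p * \<mu>)) ^ card I * activity_rate L \<nu> p \<mu> I J
    = (\<nu> / (p * \<mu>)) ^ card J * activity_rate L \<nu> p \<mu> J I"
proof (cases "activity_rate L \<nu> p \<mu> I J = 0 \<and> activity_rate L \<nu> p \<mu> J I = 0")
  case False
  then have "(\<exists>v. v \<notin> I \<and> J = insert v I) \<or> (\<exists>v. v \<notin> J \<and> I = insert v J)"
    using activity_rate_nonzero_cases[of L \<nu> p \<mu> I J] activity_rate_nonzero_cases[of L \<nu> p \<mu> J I]
    by metis
  then show ?thesis
    using activity_rate_insert_balance[OF assms(1-3)] assms(4,5) finite_independent_set by metis
qed simp

text \<open>Additions do not leave the well, so an exit removes a particle and ends at a set of size
  at most L^2/2 - (L + 1). By detailed balance its flow is \<open>\<nu>\<close> times the weight of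
  that smaller set.\<close>

lemma even_well_exit_flow:
  assumes L: "even L" "4 \<le> L" and pos: "0 < \<nu>" "0 < p" "0 < \<mu>" and s: "1 \<le> \<nu> / (p * \<mu>)"
    and I: "I \<in> even_well L" and J: "J \<in> independent_sets L - even_well L"
  shows "(\<nu> / (p * \<mu>)) ^ card I * activity_rate L \<nu> p \<mu> I J
    \<le> \<nu> / (\<nu> / (p * \<mu>)) ^ (L + 1) * (\<nu> / (p * \<mu>)) ^ card (even_vertices L)"
proof (cases "activity_rate L \<nu> p \<mu> I J = 0")
  case True
  then show ?thesis using pos by simp
next
  case False
  let ?\<sigma> = "\<nu> / (p * \<mu>)"
  from False show ?thesis
  proof (cases rule: activity_rate_nonzero_cases)
    case (add v)
    then show ?thesis using even_well_add[OF L I, of v] J by simp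
  next
    case (remove v)
    have J': "J \<in> independent_sets L" "finite J" using J finite_independent_set by auto
    have card: "card I = card J + 1" using remove J' by simp
    have "2 * card J + 2 * (L + 1) \<le> L * L"
    proof (cases "I \<in> even_core L")
      case True
      then have less: "2 * card J < L * L - 2 * L"
        using even_core_remove[OF L, of v J] remove J by auto
      have "even (L * L - 2 * L)" using L(1) by simp
      then obtain m where m: "L * L - 2 * L = 2 * m" by (elim evenE)
      have "card J < m" using less unfolding m by simp
      \<comment> \<open>Needed to undo the truncated subtraction in \<open>m\<close>.\<close>
      moreover have "2 * L \<le> L * L"
        using L by (intro mult_right_mono) simp_all
      with m have "L * L = 2 * m + 2 * L" by linarith
      ultimately show ?thesis by simp
    next
      case False
      then have "2 * int (card I) = int L * int L - 2 * int L"
        using I by (simp add: even_well_def)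
      then have "int (2 * card J + 2 * (L + 1)) = int (L * L)"
        using card by (simp add: algebra_simps)
      then show ?thesis by linarith
    qed
    then have le: "card J + (L + 1) \<le> card (even_vertices L)"
      using card_even_odd_vertices(1)[of L] L by simp
    have "I \<in> independent_sets L"
      using I by (auto simp: even_well_def even_core_def)
    then have "?\<sigma> ^ card I * activity_rate L \<nu> p \<mu> I J = ?\<sigma> ^ card J * \<nu>"
      using remove pos card by (simp add: activity_rate_insert)
    also have "\<dots> = \<nu> / ?\<sigma> ^ (L + 1) * ?\<sigma> ^ (card J + (L + 1))"
      using pos by (simp add: power_add)
    also have "\<dots> \<le> \<nu> / ?\<sigma> ^ (L + 1) * ?\<sigma> ^ card (even_vertices L)"
      using pos s le by (intro mult_left_mono power_increasing) auto
    finally show ?thesis .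
  qed
qed

text \<open>\<open>K\<close> multiplies the bound for one exit by the square of the number of
  states, which bounds the number of pairs. The result uses that \<nu> / \<sigma>^(L + 1) equals p
  \<mu> / \<sigma>^L.\<close>

lemma activity_hitting_time_lower_bound:
  assumes L: "even L" "4 \<le> L" and pos: "0 < \<nu>" "0 < p" "0 < \<mu>" and s: "1 \<le> \<nu> / (p * \<mu>)"
    and ap: "activity_process L \<nu> p \<mu> (even_vertices L) M X"
  shows "ennreal ((\<nu> / (p * \<mu>)) ^ L / (4 * real (card (independent_sets L)) ^ 2 * \<mu> * p))
    \<le> (\<integral>\<^sup>+\<omega>. hitting_time X (odd_vertices L) \<omega> \<partial>M)"
proof -
  let ?\<sigma> = "\<nu> / (p * \<mu>)" and ?S = "independent_sets L" and ?A = "even_well L"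
  define c where "c = \<nu> / ?\<sigma> ^ (L + 1) * ?\<sigma> ^ card (even_vertices L)"
  define K where "K = real (card ?S) ^ 2 * \<nu> / ?\<sigma> ^ (L + 1)"
  have \<sigma>: "0 < ?\<sigma>" using s by linarith
  have A: "?A \<subseteq> ?S" by (auto simp: even_well_def even_core_def)
  have S: "0 < card ?S"
    using even_odd_vertices_independent(1)[OF L(1)] finite_independent_sets[of L]
    by (auto simp: card_gt_0_iff)
  have K: "0 < K" using S pos \<sigma> unfolding K_def by simp
  have "0 \<le> c" using pos \<sigma> unfolding c_def by simp
  have "ennreal (1 / (4 * K)) \<le> (\<integral>\<^sup>+\<omega>. hitting_time X (odd_vertices L) \<omega> \<partial>M)"
  proof (rule reversible_hitting_time_lower_bound[where A = ?A and \<pi> = "\<lambda>I. ?\<sigma> ^ card I"])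
    show "markov_jump_process ?S (activity_rate L \<nu> p \<mu>) (even_vertices L) M X"
      using ap unfolding activity_process_def .
    show "odd_vertices L \<in> ?S - ?A"
      using odd_vertices_notin_even_well[OF L] even_odd_vertices_independent[OF L(1)] by simp
    have "(\<Sum>I\<in>?A. \<Sum>J\<in>?S - ?A. ?\<sigma> ^ card I * activity_rate L \<nu> p \<mu> I J)
        \<le> (\<Sum>I\<in>?A. \<Sum>J\<in>?S - ?A. c)"
      unfolding c_def by (intro sum_mono even_well_exit_flow[OF L pos s])
    also have "\<dots> = real (card ?A) * real (card (?S - ?A)) * c"
      by simp
    also have "\<dots> \<le> real (card ?S) * real (card ?S) * c"
      using A finite_independent_sets[of L] \<open>0 \<le> c\<close>
      by (intro mult_right_mono mult_mono) (auto intro: card_mono)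
    also have "\<dots> = K * ?\<sigma> ^ card (even_vertices L)"
      by (simp add: K_def c_def power2_eq_square)
    finally show "(\<Sum>I\<in>?A. \<Sum>J\<in>?S - ?A. ?\<sigma> ^ card I * activity_rate L \<nu> p \<mu> I J)
        \<le> K * ?\<sigma> ^ card (even_vertices L)" .
  qed (use \<sigma> K A even_vertices_in_even_well[OF L] activity_rate_balance[OF pos] in auto)
  also have "1 / (4 * K) = ?\<sigma> ^ L / (4 * real (card ?S) ^ 2 * \<mu> * p)"
    using pos S by (simp add: K_def field_simps)
  finally show ?thesis .
qed

section \<open>Logarithmic asymptotics\<close>

lemma ln_ennreal_lower_bound:
  assumes "0 < r" "ennreal r \<le> x"
  shows "ereal (ln r) \<le> ln_ennreal x"
proof (cases x)
  case (real q)
  then have "r \<le> q" using assms by (simp add: ennreal_le_iff2)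
  then show ?thesis using assms real by (simp add: ln_ennreal_def)
next
  case top
  then show ?thesis by (simp add: ln_ennreal_def)
qed

text \<open>Replacing \<open>a i\<close> by a real \<open>s\<close> below its limit inferior makes
  the error terms vanish. This also covers unbounded \<open>a\<close>, where
  \<open>a i * m / y i\<close> need not tend to 0, and an infinite limit inferior.\<close>

lemma Liminf_log_bound:
  fixes a y :: "'i \<Rightarrow> real" and h :: "'i \<Rightarrow> ereal"
  assumes y: "filterlim y at_top F"
    and h: "\<forall>\<^sub>F i in F. ereal ((l * y i + a i * (y i + m) - c) / y i) \<le> h i"
  shows "ereal l + Liminf F (\<lambda>i. ereal (a i)) \<le> Liminf F h"
  unfolding le_Liminf_iff
proof (intro allI impI)
  fix z assume "z < ereal l + Liminf F (\<lambda>i. ereal (a i))"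
  then have "z - ereal l < Liminf F (\<lambda>i. ereal (a i))"
    by (simp add: ereal_minus_less add.commute)
  then obtain s where s: "z - ereal l < ereal s" "ereal s < Liminf F (\<lambda>i. ereal (a i))"
    using ereal_dense2 by blast
  have z: "z < ereal (l + s)"
    using s(1) by (simp add: ereal_minus_less add.commute)
  have inv: "((\<lambda>i. k / y i) \<longlongrightarrow> 0) F" for k
    by (rule real_tendsto_divide_at_top[OF tendsto_const y])
  have "((\<lambda>i. l + s * (1 + m / y i) - c / y i) \<longlongrightarrow> l + s * (1 + 0) - 0) F"
    by (intro tendsto_intros inv)
  then have "((\<lambda>i. ereal (l + s * (1 + m / y i) - c / y i)) \<longlongrightarrow> ereal (l + s)) F"
    by simp
  then have ev1: "\<forall>\<^sub>F i in F. z < ereal (l + s * (1 + m / y i) - c / y i)"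
    using z by (rule order_tendstoD)
  have ev2: "\<forall>\<^sub>F i in F. ereal s < ereal (a i)"
    using s(2) by (rule less_LiminfD)
  \<comment> \<open>Both \<open>y i\<close> and \<open>y i + m\<close> are then positive, so the
    bound is monotone in \<open>a i\<close>.\<close>
  have ev3: "\<forall>\<^sub>F i in F. max 1 (- m) < y i"
    using y unfolding filterlim_at_top_dense by blast
  show "\<forall>\<^sub>F i in F. z < h i"
    using ev1 ev2 ev3 h
  proof eventually_elim
    case (elim i)
    then have pos: "0 < y i" "0 < y i + m" "s < a i" by auto
    have "l + s * (1 + m / y i) - c / y i = (l * y i + s * (y i + m) - c) / y i"
      using pos by (simp add: field_simps)
    also have "\<dots> \<le> (l * y i + a i * (y i + m) - c) / y i"
      using pos by (intro divide_right_mono add_right_mono diff_right_mono add_left_mono mult_right_mono) auto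
    finally have "ereal (l + s * (1 + m / y i) - c / y i) \<le> ereal ((l * y i + a i * (y i + m) - c) / y i)"
      by simp
    with elim show ?case by (meson less_le_trans)
  qed
qed

theorem theorem3p1:
  fixes L :: nat
    and \<mu> :: real
    and \<nu> p \<sigma> :: "'i \<Rightarrow> real"
    and F :: "'i filter"
    and M :: "'i \<Rightarrow> 'w measure"
    and X :: "'i \<Rightarrow> real \<Rightarrow> 'w \<Rightarrow> (nat \<times> nat) set"
    and \<alpha> :: ereal
  assumes "even L" and "4 \<le> L"
    and "0 < \<mu>"
    and "\<And>i. 0 < \<nu> i"
    and "\<And>i. 0 < p i \<and> p i \<le> 1"
    and "\<And>i. \<sigma> i = \<nu> i / (p i * \<mu>)"
    and "filterlim \<sigma> at_top F"
    and "\<And>i. activity_process L (\<nu> i) (p i) \<mu> (even_vertices L) (M i) (X i)"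
    and "\<alpha> = Liminf F (\<lambda>i. ereal (ln (p i) / (ln (p i) - ln (\<nu> i))))"
  shows "0 \<le> \<alpha> \<and>
    ereal (real L) \<le> ereal (real L) + \<alpha> \<and>
    ereal (real L) + \<alpha> \<le>
      Liminf F (\<lambda>i. ln_ennreal (\<integral>\<^sup>+\<omega>. hitting_time (X i) (odd_vertices L) \<omega> \<partial>M i)
                        / ereal (ln (\<sigma> i)))"
proof -
  have ln_quotient: "ln (x ^ L / (c * q)) = real L * ln x - (ln c + ln q)"
    if "0 < x" "0 < c" "0 < q" for x c q :: real
    using that by (simp add: ln_div ln_mult ln_realpow)
  have lim: "filterlim (\<lambda>i. ln (\<sigma> i)) at_top F"
    by (rule filterlim_compose[OF ln_at_top assms(7)])
  \<comment> \<open>The bound \<open>- ln \<mu>\<close> is what makes the denominator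
    \<open>ln (p i) - ln (\<nu> i)\<close> negative.\<close>
  have "\<forall>\<^sub>F i in F. max 0 (- ln \<mu>) < ln (\<sigma> i)"
    using lim unfolding filterlim_at_top_dense by blast
  moreover have ln_\<sigma>: "ln (\<sigma> i) = ln (\<nu> i) - ln (p i) - ln \<mu>" for i
    using assms(3) assms(4)[of i] assms(5)[of i] by (simp add: assms(6) ln_div ln_mult)
  ultimately have large: "\<forall>\<^sub>F i in F. 0 < ln (\<sigma> i) \<and> ln (p i) - ln (\<nu> i) < 0"
    by (auto elim!: eventually_mono)
  have "0 \<le> \<alpha>"
    unfolding assms(9)
  proof (rule Liminf_bounded)
    show "\<forall>\<^sub>F i in F. 0 \<le> ereal (ln (p i) / (ln (p i) - ln (\<nu> i)))"
      using large
    proof eventually_elim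
      case (elim i)
      then have "0 \<le> ln (p i) / (ln (p i) - ln (\<nu> i))"
        using assms(5)[of i] by (intro divide_nonpos_nonpos) auto
      then show ?case by simp
    qed
  qed
  moreover from this have "ereal (real L) \<le> ereal (real L) + \<alpha>"
    using add_left_mono[of 0 \<alpha> "ereal (real L)"] by simp
  moreover have "ereal (real L) + \<alpha> \<le>
      Liminf F (\<lambda>i. ln_ennreal (\<integral>\<^sup>+\<omega>. hitting_time (X i) (odd_vertices L) \<omega> \<partial>M i)
                        / ereal (ln (\<sigma> i)))"
    unfolding assms(9)
  proof (rule Liminf_log_bound[OF lim])
    let ?C = "4 * real (card (independent_sets L)) ^ 2 * \<mu>"
    have "0 < card (independent_sets L)"
      using even_odd_vertices_independent(1)[OF assms(1)] finite_independent_sets[of L]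
      by (auto simp: card_gt_0_iff)
    then have C: "0 < ?C" using assms(3) by simp
    show "\<forall>\<^sub>F i in F. ereal ((real L * ln (\<sigma> i)
          + ln (p i) / (ln (p i) - ln (\<nu> i)) * (ln (\<sigma> i) + ln \<mu>) - ln ?C) / ln (\<sigma> i))
        \<le> ln_ennreal (\<integral>\<^sup>+\<omega>. hitting_time (X i) (odd_vertices L) \<omega> \<partial>M i) / ereal (ln (\<sigma> i))"
      using large
    proof eventually_elim
      case (elim i)
      let ?E = "\<integral>\<^sup>+\<omega>. hitting_time (X i) (odd_vertices L) \<omega> \<partial>M i"
      have pos: "0 < \<nu> i" "0 < p i" using assms(4,5) by simp_all
      then have "0 < \<sigma> i" using assms(3) by (simp add: assms(6))
      then have "1 \<le> \<sigma> i" using elim by (simp add: ln_gt_zero_iff)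
      then have E: "ennreal (\<sigma> i ^ L / (?C * p i)) \<le> ?E"
        using activity_hitting_time_lower_bound[OF assms(1,2) pos assms(3) _ assms(8)]
        unfolding assms(6) by simp
      \<comment> \<open>\<open>ln (\<sigma> i) + ln \<mu>\<close> is the negative of the
        denominator; this turns the factor \<open>1 / p i\<close> of the bound into the exponent
        \<alpha>.\<close>
      have "ln (p i) / (ln (p i) - ln (\<nu> i)) * (ln (\<sigma> i) + ln \<mu>) = - ln (p i)"
        using elim by (simp add: ln_\<sigma> field_simps)
      moreover have "ln (\<sigma> i ^ L / (?C * p i)) = real L * ln (\<sigma> i) - (ln ?C + ln (p i))"
        using \<open>0 < \<sigma> i\<close> C pos by (intro ln_quotient)
      ultimately have "ereal (real L * ln (\<sigma> i)
          + ln (p i) / (ln (p i) - ln (\<nu> i)) * (ln (\<sigma> i) + ln \<mu>) - ln ?C)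
          = ereal (ln (\<sigma> i ^ L / (?C * p i)))"
        by simp
      also have "\<dots> \<le> ln_ennreal ?E"
        using \<open>0 < \<sigma> i\<close> C pos by (intro ln_ennreal_lower_bound E) simp
      finally have "ereal (real L * ln (\<sigma> i)
          + ln (p i) / (ln (p i) - ln (\<nu> i)) * (ln (\<sigma> i) + ln \<mu>) - ln ?C) / ereal (ln (\<sigma> i))
          \<le> ln_ennreal ?E / ereal (ln (\<sigma> i))"
        using elim by (intro ereal_divide_right_mono) auto
      then show ?case using elim by simp
    qed
  qed
  ultimately show ?thesis by simp
qed

end
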